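(* Let $P$ be an atomized poset and let $k\geq 1$ be an integer such that no set of at most $k$ atoms of $P$ generates $P$ (i.e. every set of at most $k$ atoms has an upper bound in $P$). Then $|P|$ is $(k-2)$-connected. In particular, for any group $G$: (1) if $G$ cannot be generated by $k$ elements, then $|\mathcal{C}(G)|$ is $(k-1)$-connected; (2) if $G$ is a torsion group in which any $k$ elements of prime order generate a proper subgroup of $G$, then $|L(G)|$ is $(k-2)$-connected.
   Context: For a poset $P$, $|P|$ denotes the geometric realization of the order complex $\Delta(P)$, the simplicial complex whose simplices are the finite nonempty chains of $P$; topological notions for $P$ refer to $|P|$. A poset $P$ is atomized if every element of $P$ lies above some minimal element and every finite set of minimal elements that has an upper bound in $P$ has a join (least upper bound) in $P$. Minimal elements are called atoms. A finite set $S$ of atoms generates its join, and is said to generate $P$ if $S$ has no upper bound in $P$. For a group $G$, the coset poset $\mathcal{C}(G)$ is the set of all left cosets $xH$ ($x\in G$) of all proper subgroups $H<G$ (including the trivial subgroup), ordered by inclusion. The subgroup poset $L(G)$ is the set of proper nontrivial subgroups of $G$, ordered by inclusion. Convention: a space is $(-1)$-connected iff nonempty, every space is $(-2)$-connected, and the empty space is not $0$-connected. *)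

theory Defs
  imports "HOL-Analysis.Analysis" "HOL-Algebra.Algebra"
begin

definition chain_in :: "'a::order set \<Rightarrow> 'a set \<Rightarrow> bool" where
  "chain_in P C \<longleftrightarrow> C \<subseteq> P \<and> (\<forall>x\<in>C. \<forall>y\<in>C. x \<le> y \<or> y \<le> x)"

definition atoms :: "'a::order set \<Rightarrow> 'a set" where
  "atoms P = {a \<in> P. \<not> (\<exists>b\<in>P. b < a)}"

definition has_upper_bound :: "'a::order set \<Rightarrow> 'a set \<Rightarrow> bool" where
  "has_upper_bound P S \<longleftrightarrow> (\<exists>u\<in>P. \<forall>s\<in>S. s \<le> u)"

definition is_join :: "'a::order set \<Rightarrow> 'a set \<Rightarrow> 'a \<Rightarrow> bool" where
  "is_join P S j \<longleftrightarrow> j \<in> P \<and> (\<forall>s\<in>S. s \<le> j) \<and> (\<forall>u\<in>P. (\<forall>s\<in>S. s \<le> u) \<longrightarrow> j \<le> u)"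

definition atomized :: "'a::order set \<Rightarrow> bool" where
  "atomized P \<longleftrightarrow>
     (\<forall>x\<in>P. \<exists>a\<in>atoms P. a \<le> x) \<and>
     (\<forall>S. finite S \<and> S \<noteq> {} \<and> S \<subseteq> atoms P \<and> has_upper_bound P S \<longrightarrow> (\<exists>j. is_join P S j))"

definition realization_points :: "'a::order set \<Rightarrow> ('a \<Rightarrow> real) set" where
  "realization_points P =
     {f. finite {x. f x \<noteq> 0} \<and> {x. f x \<noteq> 0} \<noteq> {} \<and> chain_in P {x. f x \<noteq> 0} \<and>
         (\<forall>x. f x \<ge> 0) \<and> (\<Sum>x\<in>{x. f x \<noteq> 0}. f x) = 1}"

definition closed_simplex :: "'a::order set \<Rightarrow> 'a set \<Rightarrow> ('a \<Rightarrow> real) set" where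
  "closed_simplex P C = {f \<in> realization_points P. {x. f x \<noteq> 0} \<subseteq> C}"

text \<open>Each closed simplex carries its Euclidean topology (subspace of the product
  topology on functions, which on a finite support is the Euclidean topology);
  the realization carries the coherent (weak) topology.\<close>
definition realization :: "'a::order set \<Rightarrow> ('a \<Rightarrow> real) topology" where
  "realization P = topology (\<lambda>U. U \<subseteq> realization_points P \<and>
     (\<forall>C. finite C \<and> chain_in P C \<longrightarrow>
        openin (subtopology (powertop_real UNIV) (closed_simplex P C)) (U \<inter> closed_simplex P C)))"

text \<open>Y is n-connected (n an integer): if n \<ge> -1 then X is nonempty, and for every
  0 \<le> m \<le> n every continuous map from the m-sphere into Y is homotopic to a
  constant map (i.e. extends to the (m+1)-disc).  Every space is (-2)-connected.\<close>
definition n_connected :: "int \<Rightarrow> 'a topology \<Rightarrow> bool" where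
  "n_connected n Y \<longleftrightarrow>
     (n \<ge> -1 \<longrightarrow> topspace Y \<noteq> {}) \<and>
     (\<forall>m::nat. int m \<le> n \<longrightarrow>
        (\<forall>f. continuous_map (nsphere m) Y f \<longrightarrow>
             (\<exists>c \<in> topspace Y. homotopic_with (\<lambda>_. True) (nsphere m) Y f (\<lambda>_. c))))"

definition coset_poset :: "('g, 'b) monoid_scheme \<Rightarrow> 'g set set" where
  "coset_poset G = {l_coset G x H | x H. x \<in> carrier G \<and> subgroup H G \<and> H \<noteq> carrier G}"

definition subgroup_poset :: "('g, 'b) monoid_scheme \<Rightarrow> 'g set set" where
  "subgroup_poset G = {H. subgroup H G \<and> H \<noteq> {\<one>\<^bsub>G\<^esub>} \<and> H \<noteq> carrier G}"

definition torsion_group :: "('g, 'b) monoid_scheme \<Rightarrow> bool" where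
  "torsion_group G \<longleftrightarrow> (\<forall>x\<in>carrier G. \<exists>n::nat. n > 0 \<and> x [^]\<^bsub>G\<^esub> n = \<one>\<^bsub>G\<^esub>)"

end

theory Submission
  imports Defs
begin

text \<open>
  Let \<open>f\<close> map the \<open>m\<close>-sphere into \<open>|P|\<close>, where \<open>m + 2 \<le> k\<close>. The open sets \<open>U b\<close>, consisting of
  the points of \<open>|P|\<close> with a positive coordinate at some \<open>p \<ge> b\<close>, cover \<open>|P|\<close> as \<open>b\<close> runs over
  the atoms. Cover \<open>\<real>\<^sup>m\<^sup>+\<^sup>1\<close> by the supports of the hat functions of a fine Freudenthal triangulation
  and choose for every lattice point \<open>z\<close> an atom \<open>a z\<close> such that \<open>f\<close> maps the part of the sphere
  near \<open>z\<close> into \<open>U (a z)\<close>. At most \<open>m + 2\<close> hat functions are positive at a given point, so the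
  atoms belonging to them have a join, and sending the barycentre of a simplex to the join of its
  atoms defines a map \<open>G\<close> on the whole ball; its restriction to the sphere is null-homotopic.
  Finally \<open>f\<close> is homotopic to \<open>G\<close>: damp the coordinate of \<open>f x\<close> at \<open>p\<close> to \<open>0\<close> when \<open>p\<close> fails to
  lie above \<open>a z\<close> for some \<open>z\<close> near \<open>x\<close>. The coordinate at the greatest vertex of the carrier
  of \<open>f x\<close> survives, and all surviving vertices lie above the joins used by \<open>G x\<close>, so straight
  lines connect \<open>f\<close> to the damped map and the damped map to \<open>G\<close>.

  The atoms of the coset poset are the singletons, and \<open>{x\<^sub>0}, ..., {x\<^sub>k}\<close> are bounded by
  a coset of the subgroup generated by the \<open>k\<close> elements \<open>inv x\<^sub>0 x\<^sub>i\<close>. The atoms of the subgroup poset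
  of a torsion group are subgroups of prime order.
\<close>

subsection \<open>Maps into the realization of a poset\<close>

lemma chain_in_subset: "chain_in P C \<Longrightarrow> D \<subseteq> C \<Longrightarrow> chain_in P D"
  unfolding chain_in_def by blast

text \<open>\<open>topology\<close> returns the intended structure only for a predicate satisfying
  \<open>istopology\<close>; this holds because intersecting with a closed simplex commutes with
  finite intersections and with unions.\<close>

lemma openin_realization:
  "openin (realization P) U \<longleftrightarrow> U \<subseteq> realization_points P \<and>
     (\<forall>C. finite C \<and> chain_in P C \<longrightarrow>
        openin (top_of_set (closed_simplex P C)) (U \<inter> closed_simplex P C))"
proof -
  let ?L = "\<lambda>U. U \<subseteq> realization_points P \<and> (\<forall>C. finite C \<and> chain_in P C \<longrightarrow>
        openin (top_of_set (closed_simplex P C)) (U \<inter> closed_simplex P C))"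
  have "istopology ?L"
    unfolding istopology_def
  proof (intro conjI allI impI)
    fix S T C assume "?L S" "?L T" "finite C \<and> chain_in P C"
    moreover have "S \<inter> T \<inter> closed_simplex P C
        = (S \<inter> closed_simplex P C) \<inter> (T \<inter> closed_simplex P C)" by blast
    ultimately show "openin (top_of_set (closed_simplex P C)) (S \<inter> T \<inter> closed_simplex P C)"
      using openin_Int by metis
  next
    fix K C assume "\<forall>S\<in>K. ?L S" "finite C \<and> chain_in P C"
    moreover have "\<Union>K \<inter> closed_simplex P C = (\<Union>S\<in>K. S \<inter> closed_simplex P C)" by blast
    ultimately show "openin (top_of_set (closed_simplex P C)) (\<Union>K \<inter> closed_simplex P C)"
      by (metis (no_types, lifting) imageE openin_Union)
  qed blast+
  then show ?thesis
    unfolding realization_def euclidean_product_topology by simp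
qed

lemma topspace_realization [simp]: "topspace (realization P) = realization_points P"
proof
  show "topspace (realization P) \<subseteq> realization_points P"
    using openin_realization openin_topspace by blast
  have "realization_points P \<inter> closed_simplex P C = closed_simplex P C" for C
    unfolding closed_simplex_def by blast
  then have "openin (realization P) (realization_points P)"
    by (simp add: openin_realization)
  then show "realization_points P \<subseteq> topspace (realization P)"
    by (rule openin_subset)
qed

lemma closedin_realization:
  "closedin (realization P) T \<longleftrightarrow> T \<subseteq> realization_points P \<and>
     (\<forall>C. finite C \<and> chain_in P C \<longrightarrow>
        closedin (top_of_set (closed_simplex P C)) (T \<inter> closed_simplex P C))"
proof -
  have "(realization_points P - T) \<inter> closed_simplex P C
      = closed_simplex P C - T \<inter> closed_simplex P C" for C
    unfolding closed_simplex_def by blast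
  then show ?thesis
    by (auto simp: closedin_def openin_realization)
qed

text \<open>Summing over the fixed set \<open>C\<close> instead of the varying support turns
  membership into closed conditions on coordinates, which are also stable under convex
  combinations.\<close>

lemma closed_simplex_eq:
  assumes "finite C" "chain_in P C"
  shows "closed_simplex P C = {f. (\<forall>x. 0 \<le> f x) \<and> (\<forall>x. x \<notin> C \<longrightarrow> f x = 0) \<and> sum f C = 1}"
    (is "?L = ?R")
proof (rule Set.set_eqI, rule iffI)
  fix f assume "f \<in> ?L"
  then have f: "{x. f x \<noteq> 0} \<subseteq> C" "\<forall>x. 0 \<le> f x" "sum f {x. f x \<noteq> 0} = 1"
    by (auto simp: closed_simplex_def realization_points_def)
  moreover have "sum f C = sum f {x. f x \<noteq> 0}"
    using f(1) assms(1) by (intro sum.mono_neutral_right) auto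
  ultimately show "f \<in> ?R" by auto
next
  fix f assume f: "f \<in> ?R"
  then have sub: "{x. f x \<noteq> 0} \<subseteq> C" by auto
  have "sum f {x. f x \<noteq> 0} = sum f C"
    using sub assms(1) by (intro sum.mono_neutral_left) auto
  moreover have "{x. f x \<noteq> 0} \<noteq> {}"
    using calculation f by (metis (mono_tags, lifting) mem_Collect_eq sum.empty zero_neq_one)
  ultimately show "f \<in> ?L"
    using f sub assms chain_in_subset[OF assms(2) sub] finite_subset[OF sub]
    by (simp add: closed_simplex_def realization_points_def)
qed

lemma closed_closed_simplex:
  assumes "finite C" "chain_in P C"
  shows "closed (closed_simplex P C)"
  unfolding closed_simplex_eq[OF assms]
  by (intro closed_Collect_conj closed_Collect_all closed_Collect_imp open_Collect_const
      closed_Collect_le closed_Collect_eq continuous_intros continuous_on_product_coordinates)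

lemma realization_pointsI:
  assumes "finite C" "chain_in P C" "\<And>x. 0 \<le> f x" "\<And>x. x \<notin> C \<Longrightarrow> f x = 0" "sum f C = 1"
  shows "f \<in> realization_points P"
proof -
  have "f \<in> closed_simplex P C" using assms by (simp add: closed_simplex_eq)
  then show ?thesis by (simp add: closed_simplex_def)
qed

text \<open>The weak topology may be finer than the product topology. With a finite vertex set
  \<open>V\<close> only finitely many chains occur, so the preimage of a closed set is a finite
  union of preimages of sets closed in the function space, and continuity of coordinates
  suffices.\<close>

lemma continuous_map_into_realization:
  fixes h :: "'x::topological_space \<Rightarrow> 'a::order \<Rightarrow> real"
  assumes "finite V"
    and h: "\<And>x. x \<in> S \<Longrightarrow> h x \<in> realization_points P"
    and supp: "\<And>x. x \<in> S \<Longrightarrow> {p. h x p \<noteq> 0} \<subseteq> V"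
    and cont: "\<And>p. continuous_on S (\<lambda>x. h x p)"
  shows "continuous_map (top_of_set S) (realization P) h"
  unfolding continuous_map_closedin
proof (intro conjI ballI allI impI)
  fix T assume T: "closedin (realization P) T"
  define \<D> where "\<D> = {C. C \<subseteq> V \<and> chain_in P C}"
  have fin: "finite \<D>" using \<open>finite V\<close> by (simp add: \<D>_def)
  have conth: "continuous_on S h"
    by (rule continuous_on_coordinatewise_then_product) (rule cont)
  have "closedin (top_of_set S) {x \<in> S. h x \<in> T \<inter> closed_simplex P C}" if "C \<in> \<D>" for C
  proof -
    have C: "finite C" "chain_in P C" using that \<open>finite V\<close> finite_subset by (auto simp: \<D>_def)
    have "closed (T \<inter> closed_simplex P C)"
      using T C closed_closed_simplex[OF C] by (auto simp: closedin_realization intro: closedin_closed_trans)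
    from continuous_closedin_preimage[OF conth this]
    show ?thesis by (simp add: vimage_def Int_def)
  qed
  then have "closedin (top_of_set S) (\<Union>C\<in>\<D>. {x \<in> S. h x \<in> T \<inter> closed_simplex P C})"
    using fin by (intro closedin_Union) auto
  moreover have "{x \<in> topspace (top_of_set S). h x \<in> T} =
      (\<Union>C\<in>\<D>. {x \<in> S. h x \<in> T \<inter> closed_simplex P C})"
  proof -
    have "\<exists>C\<in>\<D>. h x \<in> closed_simplex P C" if "x \<in> S" for x
      using h[OF that] supp[OF that]
      by (intro bexI[of _ "{p. h x p \<noteq> 0}"])
        (auto simp: \<D>_def closed_simplex_def realization_points_def)
    then show ?thesis by auto
  qed
  ultimately show "closedin (top_of_set S) {x \<in> topspace (top_of_set S). h x \<in> T}" by simp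
qed (use h in auto)

text \<open>The weak topology contains every relatively open set of the product topology. This makes
  the coordinates continuous and opens the sets used to cover the sphere.\<close>

lemma openin_realization_Collect:
  assumes "open {f. Q f}"
  shows "openin (realization P) {f \<in> realization_points P. Q f}"
proof -
  have "{f \<in> realization_points P. Q f} \<inter> closed_simplex P C = closed_simplex P C \<inter> {f. Q f}" for C
    unfolding closed_simplex_def by blast
  then show ?thesis
    using assms by (auto simp: openin_realization)
qed

lemma continuous_map_coordinate:
  "continuous_map (realization P) euclideanreal (\<lambda>f. f p)"
  unfolding continuous_map
proof (intro conjI allI impI)
  fix U :: "real set" assume "openin euclideanreal U"
  then have "open {f :: 'a \<Rightarrow> real. f p \<in> U}"
    using open_vimage[OF _ continuous_on_product_coordinates] by (simp add: vimage_def)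
  then show "openin (realization P) {f \<in> topspace (realization P). f p \<in> U}"
    using openin_realization_Collect by simp
qed auto

lemma open_Collect_pos_coordinate: "open {f :: 'a \<Rightarrow> real. \<exists>p\<in>A. 0 < f p}"
proof -
  have "open {f :: 'a \<Rightarrow> real. 0 < f p}" for p
    by (intro open_Collect_less continuous_intros continuous_on_product_coordinates)
  then have "open (\<Union>p\<in>A. {f :: 'a \<Rightarrow> real. 0 < f p})" by blast
  moreover have "(\<Union>p\<in>A. {f :: 'a \<Rightarrow> real. 0 < f p}) = {f. \<exists>p\<in>A. 0 < f p}" by blast
  ultimately show ?thesis by simp
qed

lemma finite_imp_closed_fun:
  fixes A :: "('a \<Rightarrow> real) set"
  assumes "finite A"
  shows "closed A"
proof -
  have "closed {f}" for f :: "'a \<Rightarrow> real"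
  proof -
    have "{f} = {g. \<forall>x. g x = f x}" by (auto simp: fun_eq_iff)
    moreover have "closed {g :: 'a \<Rightarrow> real. \<forall>x. g x = f x}"
      by (intro closed_Collect_all closed_Collect_eq continuous_intros continuous_on_product_coordinates)
    ultimately show ?thesis by simp
  qed
  then have "closed (\<Union>f\<in>A. {f})" using assms by (intro closed_UN) auto
  then show ?thesis by simp
qed

text \<open>One point is chosen from each open simplex that meets \<open>K\<close>. A closed simplex contains only
  finitely many of them, so every set of chosen points is closed.\<close>
lemma compactin_realization_finite_vertices:
  assumes "compactin (realization P) K"
  shows "finite (\<Union>y\<in>K. {p. y p \<noteq> 0})"
proof -
  define supp where "supp = (\<lambda>y :: 'a \<Rightarrow> real. {p. y p \<noteq> 0})"
  have KP: "K \<subseteq> realization_points P" using compactin_subset_topspace[OF assms] by simp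
  define c where "c = (\<lambda>C. SOME y. y \<in> K \<and> supp y = C)"
  have c: "c (supp y) \<in> K" "supp (c (supp y)) = supp y" if "y \<in> K" for y
    using someI[of "\<lambda>z. z \<in> K \<and> supp z = supp y" y] that by (auto simp: c_def)
  define T where "T = c ` supp ` K"
  have TK: "T \<subseteq> K" using c by (auto simp: T_def)
  have inj: "inj_on supp T"
    unfolding T_def by (rule inj_onI) (auto simp: c(2))
  have clo: "closedin (realization P) A" if A: "A \<subseteq> T" for A
    unfolding closedin_realization
  proof (intro conjI allI impI)
    show "A \<subseteq> realization_points P" using A TK KP by blast
    fix C :: "'a set" assume C: "finite C \<and> chain_in P C"
    have "supp ` (A \<inter> closed_simplex P C) \<subseteq> Pow C"
      by (auto simp: closed_simplex_def supp_def)
    then have "finite (supp ` (A \<inter> closed_simplex P C))"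
      using C finite_subset by blast
    moreover have "inj_on supp (A \<inter> closed_simplex P C)"
      using A by (intro inj_on_subset[OF inj]) blast
    ultimately have "finite (A \<inter> closed_simplex P C)"
      by (rule finite_imageD)
    then have "closed (A \<inter> closed_simplex P C)"
      by (rule finite_imp_closed_fun)
    then show "closedin (top_of_set (closed_simplex P C)) (A \<inter> closed_simplex P C)"
      by (intro closed_subset) auto
  qed
  \<comment> \<open>Each member of this cover contains exactly one point of \<open>T\<close>, so a
    finite subcover of \<open>K\<close> forces \<open>T\<close> to be finite.\<close>
  define \<U> where "\<U> = (\<lambda>t. realization_points P - (T - {t})) ` T"
  have "finite T"
  proof (cases "T = {}")
    case False
    have "\<forall>U\<in>\<U>. openin (realization P) U"
    proof
      fix U assume "U \<in> \<U>"
      then obtain t where U: "U = topspace (realization P) - (T - {t})" by (auto simp: \<U>_def)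
      show "openin (realization P) U" unfolding U
        by (intro openin_diff openin_topspace clo) auto
    qed
    moreover have "K \<subseteq> \<Union>\<U>"
    proof
      fix y assume y: "y \<in> K"
      show "y \<in> \<Union>\<U>"
        using False y KP by (cases "y \<in> T") (auto simp: \<U>_def)
    qed
    ultimately obtain \<F> where F: "finite \<F>" "\<F> \<subseteq> \<U>" "K \<subseteq> \<Union>\<F>"
      using assms unfolding compactin_def by meson
    obtain T' where T': "finite T'" "T' \<subseteq> T" "\<F> = (\<lambda>t. realization_points P - (T - {t})) ` T'"
      using F(1,2) unfolding \<U>_def by (meson finite_subset_image)
    have "T \<subseteq> T'"
      using TK F(3) T'(3) by blast
    then show ?thesis using T'(1) finite_subset by blast
  qed simp
  moreover have "(\<Union>y\<in>K. supp y) = (\<Union>t\<in>T. supp t)"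
    using c(2) by (auto simp: T_def)
  moreover have "finite (supp t)" if "t \<in> T" for t
    using that TK KP by (auto simp: realization_points_def supp_def)
  ultimately show ?thesis by (auto simp: supp_def)
qed

text \<open>The common source of \<open>nerve_point\<close> and of the damped map: weights with some
  positive value are rescaled to total 1.\<close>

lemma realization_points_normalize:
  assumes "finite V" "\<And>p. p \<in> V \<Longrightarrow> 0 \<le> v p" "q \<in> V" "0 < v q"
    "chain_in P {p \<in> V. v p \<noteq> 0}"
  shows "(\<lambda>p. if p \<in> V then v p / sum v V else (0::real)) \<in> realization_points P"
proof (rule realization_pointsI)
  have pos: "0 < sum v V" using assms by (intro sum_pos2) auto
  show "finite {p \<in> V. v p \<noteq> 0}" using assms(1) by simp
  show "chain_in P {p \<in> V. v p \<noteq> 0}" by fact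
  show "0 \<le> (if p \<in> V then v p / sum v V else 0)" for p
    using pos assms(2) by auto
  have "(\<Sum>p\<in>{p \<in> V. v p \<noteq> 0}. if p \<in> V then v p / sum v V else 0) = (\<Sum>p\<in>V. v p / sum v V)"
    using assms(1) by (intro sum.mono_neutral_cong_left) auto
  also have "\<dots> = 1" using pos by (simp add: sum_divide_distrib[symmetric])
  finally show "(\<Sum>p\<in>{p \<in> V. v p \<noteq> 0}. if p \<in> V then v p / sum v V else 0) = 1" .
qed auto

text \<open>The segment from \<open>f x\<close> to \<open>g x\<close> stays in the closed simplex on
  the union of the two supports, which is a chain; the finite set \<open>V\<close> reduces
  continuity of the homotopy to its coordinates.\<close>

lemma homotopic_into_realization:
  fixes f g :: "'x::topological_space \<Rightarrow> 'a::order \<Rightarrow> real"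
  assumes "finite V"
    and f: "\<And>x. x \<in> S \<Longrightarrow> f x \<in> realization_points P" "\<And>x. x \<in> S \<Longrightarrow> {p. f x p \<noteq> 0} \<subseteq> V"
      "\<And>p. continuous_on S (\<lambda>x. f x p)"
    and g: "\<And>x. x \<in> S \<Longrightarrow> g x \<in> realization_points P" "\<And>x. x \<in> S \<Longrightarrow> {p. g x p \<noteq> 0} \<subseteq> V"
      "\<And>p. continuous_on S (\<lambda>x. g x p)"
    and chain: "\<And>x. x \<in> S \<Longrightarrow> chain_in P ({p. f x p \<noteq> 0} \<union> {p. g x p \<noteq> 0})"
  shows "homotopic_with (\<lambda>_. True) (top_of_set S) (realization P) f g"
proof -
  define h where "h = (\<lambda>(t::real, x). \<lambda>p. (1 - t) * f x p + t * g x p)"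
  have "continuous_map (top_of_set ({0..1} \<times> S)) (realization P) h"
  proof (rule continuous_map_into_realization[OF \<open>finite V\<close>])
    fix z :: "real \<times> 'x" assume "z \<in> {0..1} \<times> S"
    then obtain t x where z: "z = (t, x)" and t: "0 \<le> t" "t \<le> 1" and x: "x \<in> S" by auto
    let ?C = "{p. f x p \<noteq> 0} \<union> {p. g x p \<noteq> 0}"
    have fin: "finite ?C" using f(2) g(2) x \<open>finite V\<close> finite_subset by (metis le_sup_iff)
    have "f x \<in> closed_simplex P ?C" "g x \<in> closed_simplex P ?C"
      using f(1) g(1) x by (auto simp: closed_simplex_def)
    then have fg: "\<forall>p. 0 \<le> f x p" "\<forall>p. 0 \<le> g x p" "sum (f x) ?C = 1" "sum (g x) ?C = 1"
      by (simp_all add: closed_simplex_eq[OF fin chain[OF x]])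
    show "h z \<in> realization_points P"
    proof (rule realization_pointsI[OF fin chain[OF x]])
      show "0 \<le> h z p" for p using t fg by (simp add: z h_def)
      have "sum (h z) ?C = (1 - t) * sum (f x) ?C + t * sum (g x) ?C"
        by (simp add: z h_def sum.distrib sum_distrib_left)
      then show "sum (h z) ?C = 1" using fg by simp
    qed (auto simp: z h_def)
    show "{p. h z p \<noteq> 0} \<subseteq> V"
    proof
      fix p assume "p \<in> {p. h z p \<noteq> 0}"
      then have "f x p \<noteq> 0 \<or> g x p \<noteq> 0" by (auto simp: z h_def)
      then show "p \<in> V" using f(2)[OF x] g(2)[OF x] by blast
    qed
  next
    fix p
    have "continuous_on ({0..1} \<times> S) (\<lambda>z. f (snd z) p)" "continuous_on ({0..1} \<times> S) (\<lambda>z. g (snd z) p)"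
      by (rule continuous_on_compose2[OF f(3)] continuous_on_compose2[OF g(3)];
          auto intro!: continuous_intros)+
    then show "continuous_on ({0..1} \<times> S) (\<lambda>z. h z p)"
      unfolding h_def case_prod_beta by (intro continuous_intros)
  qed
  then show ?thesis
    unfolding homotopic_with_def
    by (intro exI[of _ h]) (auto simp: h_def)
qed

subsection \<open>Hat functions of the Freudenthal triangulation\<close>

lemma max_0_neq_0_iff: "max 0 t \<noteq> 0 \<longleftrightarrow> 0 < t" for t :: real
  by (auto simp: max_def)

text \<open>The positivity set is the open star of the lattice point \<open>z\<close> in the
  Freudenthal triangulation of \<open>n\<close>-space, with coordinate \<open>n\<close> fixed at 0
  as a homogeneous coordinate. The product replaces the piecewise linear hat function by a
  continuous function with the same positivity set.\<close>

definition hat :: "nat \<Rightarrow> (nat \<Rightarrow> int) \<Rightarrow> (nat \<Rightarrow> real) \<Rightarrow> real" where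
  "hat n z y = (\<Prod>i\<le>n. \<Prod>j\<le>n. max 0 (1 - ((y i - z i) - (y j - z j))))"

lemma hat_nonneg: "0 \<le> hat n z y"
  unfolding hat_def by (intro prod_nonneg) auto

lemma hat_pos_iff: "0 < hat n z y \<longleftrightarrow> (\<forall>i\<le>n. \<forall>j\<le>n. (y i - z i) - (y j - z j) < 1)"
proof
  assume "0 < hat n z y"
  then have "hat n z y \<noteq> 0" by simp
  then have "\<forall>i\<le>n. \<forall>j\<le>n. max 0 (1 - ((y i - z i) - (y j - z j))) \<noteq> 0"
    unfolding hat_def by (simp add: prod_zero_iff)
  then show "\<forall>i\<le>n. \<forall>j\<le>n. (y i - z i) - (y j - z j) < 1"
    by (simp only: max_0_neq_0_iff) simp
next
  assume "\<forall>i\<le>n. \<forall>j\<le>n. (y i - z i) - (y j - z j) < 1"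
  then show "0 < hat n z y"
    unfolding hat_def by (intro prod_pos) auto
qed

text \<open>Fractional parts lie in \<open>[0, 1)\<close> and so differ by less than 1. Hence the
  open stars of the lattice points cover the space.\<close>

lemma hat_floor_pos: "0 < hat n (\<lambda>i. \<lfloor>y i\<rfloor>) y"
  unfolding hat_pos_iff
proof (intro allI impI)
  fix i j
  have "y i < \<lfloor>y i\<rfloor> + 1" "\<lfloor>y j\<rfloor> \<le> y j" by linarith+
  then show "y i - \<lfloor>y i\<rfloor> - (y j - \<lfloor>y j\<rfloor>) < 1" by linarith
qed

lemma hat_pos_imp_near:
  assumes "0 < hat n z y" "y n = 0" "z n = 0" "i \<le> n"
  shows "\<bar>y i - z i\<bar> < 1"
proof -
  have "(y i - z i) - (y n - z n) < 1" "(y n - z n) - (y i - z i) < 1"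
    using assms(1)[unfolded hat_pos_iff] assms(4) by blast+
  then show ?thesis using assms by auto
qed

text \<open>If \<open>w i < z i\<close> and \<open>z j < w j\<close>, adding the positivity
  inequality of \<open>z\<close> for \<open>(j, i)\<close> to that of \<open>w\<close> for
  \<open>(i, j)\<close> eliminates \<open>y\<close> and bounds an integer that is at least 2
  strictly by 2.\<close>

lemma hat_pos_comparable:
  assumes z: "0 < hat n z y" and w: "0 < hat n w y"
  shows "(\<forall>i\<le>n. z i \<le> w i) \<or> (\<forall>i\<le>n. w i \<le> z i)"
proof (rule ccontr)
  assume "\<not> ?thesis"
  then obtain i j where ij: "i \<le> n" "j \<le> n" "w i < z i" "z j < w j" by (meson not_le)
  have "(y j - z j) - (y i - z i) < 1" "(y i - w i) - (y j - w j) < 1"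
    using z w ij(1,2) by (auto simp: hat_pos_iff)
  moreover have "real_of_int (w i) + 1 \<le> z i" "real_of_int (z j) + 1 \<le> w j" using ij by linarith+
  ultimately show False by linarith
qed

text \<open>The lattice points whose hat function is positive at \<open>y\<close> are linearly ordered by \<open>\<le>\<close>
  and have coordinates in \<open>{\<lfloor>y i\<rfloor>, \<lfloor>y i\<rfloor> + 1}\<close>, so the coordinate sum separates them.\<close>
lemma card_hat_pos:
  assumes "y n = 0" and A: "\<And>z. z \<in> A \<Longrightarrow> (\<forall>i\<ge>n. z i = 0) \<and> 0 < hat n z y"
  shows "card A \<le> Suc n"
proof -
  define s where "s = (\<lambda>z :: nat \<Rightarrow> int. \<Sum>i<n. z i - \<lfloor>y i\<rfloor>)"
  have "inj_on s A"
  proof (rule inj_onI)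
    fix z w assume zw: "z \<in> A" "w \<in> A" "s z = s w"
    have eq: "z = w" if "z \<in> A" "w \<in> A" "s z = s w" "\<forall>i\<le>n. z i \<le> w i" for z w
    proof (rule ext)
      fix i
      have "(\<Sum>i<n. w i - z i) = 0"
        using that(3) by (simp add: s_def sum_subtractf)
      then have "\<forall>i\<in>{..<n}. w i - z i = 0"
        using that(4) by (subst (asm) sum_nonneg_eq_0_iff) auto
      then show "z i = w i" using A[OF that(1)] A[OF that(2)] by (cases "i < n") auto
    qed
    show "z = w"
      using hat_pos_comparable[of n z y w] A zw eq[of z w] eq[of w z] by auto
  qed
  moreover have "s ` A \<subseteq> {0..int n}"
  proof
    fix t assume "t \<in> s ` A"
    then obtain z where z: "z \<in> A" "t = s z" by blast
    have "0 \<le> z i - \<lfloor>y i\<rfloor> \<and> z i - \<lfloor>y i\<rfloor> \<le> 1" if "i < n" for i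
    proof -
      have "\<bar>y i - z i\<bar> < 1"
        using hat_pos_imp_near[of n z y i] A[OF z(1)] assms(1) that by auto
      then show ?thesis by linarith
    qed
    then have "0 \<le> s z" "s z \<le> (\<Sum>i<n. 1)"
      unfolding s_def by (intro sum_nonneg sum_mono; simp)+
    then show "t \<in> {0..int n}" using z by simp
  qed
  ultimately have "card A \<le> card {0..int n}" by (intro card_inj_on_le) auto
  then show ?thesis by simp
qed

subsection \<open>Barycentric maps\<close>

text \<open>For nonnegative \<open>u\<close> and \<open>B \<subseteq> Z\<close>, this is positive
  exactly when \<open>B\<close> is an upper level set: its values are positive and strictly exceed
  all values on \<open>Z - B\<close>. These sets are the vertices of the carrier of \<open>u\<close>
  in the barycentric subdivision.\<close>

definition level_weight :: "'z set \<Rightarrow> ('z \<Rightarrow> real) \<Rightarrow> 'z set \<Rightarrow> real" where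
  "level_weight Z u B = (\<Prod>z\<in>B. u z) * (\<Prod>z\<in>B. \<Prod>w\<in>Z - B. max 0 (u z - u w))"

context
  fixes Z :: "'z set" and u :: "'z \<Rightarrow> real"
  assumes fin: "finite Z" and nonneg: "\<forall>z\<in>Z. 0 \<le> u z"
begin

lemma level_weight_nonneg: "B \<subseteq> Z \<Longrightarrow> 0 \<le> level_weight Z u B"
  unfolding level_weight_def using nonneg by (intro mult_nonneg_nonneg prod_nonneg) auto

lemma level_weight_nonzero:
  assumes "B \<subseteq> Z" "level_weight Z u B \<noteq> 0"
  shows "\<And>z. z \<in> B \<Longrightarrow> 0 < u z" "\<And>z w. z \<in> B \<Longrightarrow> w \<in> Z - B \<Longrightarrow> u w < u z"
proof -
  have finB: "finite B" "finite (Z - B)" using assms fin finite_subset by auto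
  then have 1: "\<forall>z\<in>B. u z \<noteq> 0" and 2: "\<forall>z\<in>B. \<forall>w\<in>Z - B. max 0 (u z - u w) \<noteq> 0"
    using assms(2) by (auto simp: level_weight_def prod_zero_iff)
  show "0 < u z" if "z \<in> B" for z
    using 1 that nonneg assms(1) by (metis less_eq_real_def subsetD)
  show "u w < u z" if "z \<in> B" "w \<in> Z - B" for z w
    using 2 that by (simp only: max_0_neq_0_iff) simp
qed

text \<open>Points of \<open>B - C\<close> and \<open>C - B\<close> would each have a strictly
  larger value than the other.\<close>

lemma level_weight_nonzero_comparable:
  assumes B: "B \<subseteq> Z" "level_weight Z u B \<noteq> 0" and C: "C \<subseteq> Z" "level_weight Z u C \<noteq> 0"
  shows "B \<subseteq> C \<or> C \<subseteq> B"
proof (rule ccontr)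
  assume "\<not> ?thesis"
  then obtain z w where zw: "z \<in> B" "z \<notin> C" "w \<in> C" "w \<notin> B" by blast
  then have "u w < u z" "u z < u w"
    using level_weight_nonzero(2)[OF B, of z w] level_weight_nonzero(2)[OF C, of w z] B(1) C(1) by auto
  then show False by simp
qed

lemma level_weight_pos_exists:
  assumes "z0 \<in> Z" "0 < u z0"
  shows "\<exists>B\<subseteq>Z. B \<noteq> {} \<and> 0 < level_weight Z u B"
proof (intro exI conjI)
  \<comment> \<open>The set where \<open>u\<close> is largest is an upper level set, and its values
    are positive because \<open>u z0\<close> is.\<close>
  define M where "M = Max (u ` Z)"
  let ?B = "{z \<in> Z. u z = M}"
  have M: "M \<in> u ` Z" "\<And>z. z \<in> Z \<Longrightarrow> u z \<le> M"
    unfolding M_def using fin assms(1) Max_in[of "u ` Z"] by (blast, simp)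
  show "?B \<subseteq> Z" by blast
  show "?B \<noteq> {}" using M(1) by auto
  have "0 < M" using M(2)[OF assms(1)] assms(2) by simp
  moreover have "u w < M" if "w \<in> Z - ?B" for w using M(2)[of w] that by force
  ultimately show "0 < level_weight Z u ?B"
    unfolding level_weight_def by (intro mult_pos_pos prod_pos) auto
qed

end

definition nerve_vertices :: "('z set \<Rightarrow> 'a) \<Rightarrow> 'z set \<Rightarrow> 'a set" where
  "nerve_vertices J Z = J ` (Pow Z - {{}})"

text \<open>\<open>J\<close> may identify several sets, so weights are added over each fibre. The
  empty set, whose level weight is the empty product 1, must be left out.\<close>

definition nerve_weight :: "('z set \<Rightarrow> 'a) \<Rightarrow> 'z set \<Rightarrow> ('z \<Rightarrow> real) \<Rightarrow> 'a \<Rightarrow> real" where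
  "nerve_weight J Z u p = (\<Sum>B | B \<subseteq> Z \<and> B \<noteq> {} \<and> J B = p. level_weight Z u B)"

text \<open>The barycentric coordinates \<open>u\<close> determine a point in the barycentric subdivision of the
  simplex on \<open>Z\<close>, whose vertex \<open>B \<subseteq> Z\<close> is sent to \<open>J B\<close>.\<close>
definition nerve_point :: "('z set \<Rightarrow> 'a) \<Rightarrow> 'z set \<Rightarrow> ('z \<Rightarrow> real) \<Rightarrow> 'a \<Rightarrow> real" where
  "nerve_point J Z u p = (if p \<in> nerve_vertices J Z
     then nerve_weight J Z u p / sum (nerve_weight J Z u) (nerve_vertices J Z) else 0)"

lemma nerve_weight_nonzero:
  assumes "finite Z" "\<forall>z\<in>Z. 0 \<le> u z" "nerve_weight J Z u p \<noteq> 0"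
  obtains B where "B \<subseteq> {z \<in> Z. 0 < u z}" "B \<noteq> {}" "J B = p" "level_weight Z u B \<noteq> 0"
proof -
  obtain B where B: "B \<subseteq> Z" "B \<noteq> {}" "J B = p" "level_weight Z u B \<noteq> 0"
    using assms(3) unfolding nerve_weight_def by (smt (verit, best) mem_Collect_eq sum.not_neutral_contains_not_neutral)
  moreover have "B \<subseteq> {z \<in> Z. 0 < u z}"
    using level_weight_nonzero(1)[of Z u, OF assms(1,2) B(1,4)] B(1) by auto
  ultimately show ?thesis using that by blast
qed

lemma nerve_weight_nonneg:
  assumes "finite Z" "\<forall>z\<in>Z. 0 \<le> u z"
  shows "0 \<le> nerve_weight J Z u p"
  unfolding nerve_weight_def using assms by (intro sum_nonneg level_weight_nonneg) auto

lemma nerve_weight_pos_exists: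
  assumes fin: "finite Z" and nonneg: "\<forall>z\<in>Z. 0 \<le> u z" and z0: "z0 \<in> Z" "0 < u z0"
  shows "\<exists>p\<in>nerve_vertices J Z. 0 < nerve_weight J Z u p"
proof -
  obtain B where B: "B \<subseteq> Z" "B \<noteq> {}" "0 < level_weight Z u B"
    using level_weight_pos_exists[OF fin nonneg z0] by blast
  have "level_weight Z u B \<le> nerve_weight J Z u (J B)"
    unfolding nerve_weight_def
    using B fin nonneg by (intro member_le_sum) (auto intro: level_weight_nonneg)
  then show ?thesis
    using B by (intro bexI[of _ "J B"]) (auto simp: nerve_vertices_def)
qed

text \<open>The sets of nonzero weight are nested and lie in the positive part of \<open>Z\<close>.
  There \<open>J\<close> is a join and hence monotone, so their images form a chain.\<close>

lemma nerve_point_in_realization: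
  assumes fin: "finite Z" and nonneg: "\<forall>z\<in>Z. 0 \<le> u z" and z0: "z0 \<in> Z" "0 < u z0"
    and join: "\<And>B. B \<subseteq> {z \<in> Z. 0 < u z} \<Longrightarrow> B \<noteq> {} \<Longrightarrow> is_join P (a ` B) (J B)"
  shows "nerve_point J Z u \<in> realization_points P"
proof -
  obtain q where q: "q \<in> nerve_vertices J Z" "0 < nerve_weight J Z u q"
    using nerve_weight_pos_exists[where J=J, OF fin nonneg z0] by blast
  have "chain_in P {p \<in> nerve_vertices J Z. nerve_weight J Z u p \<noteq> 0}"
    unfolding chain_in_def
  proof (intro conjI ballI subsetI)
    fix p assume p: "p \<in> {p \<in> nerve_vertices J Z. nerve_weight J Z u p \<noteq> 0}"
    then have "nerve_weight J Z u p \<noteq> 0" by simp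
    then obtain B where B: "B \<subseteq> {z \<in> Z. 0 < u z}" "B \<noteq> {}" "J B = p" "level_weight Z u B \<noteq> 0"
      by (rule nerve_weight_nonzero[OF fin nonneg])
    then show "p \<in> P" using join[OF B(1,2)] by (simp add: is_join_def)
    fix q assume "q \<in> {p \<in> nerve_vertices J Z. nerve_weight J Z u p \<noteq> 0}"
    then have "nerve_weight J Z u q \<noteq> 0" by simp
    then obtain C where C: "C \<subseteq> {z \<in> Z. 0 < u z}" "C \<noteq> {}" "J C = q" "level_weight Z u C \<noteq> 0"
      by (rule nerve_weight_nonzero[OF fin nonneg])
    have mono: "J D \<le> J E" if "D \<subseteq> E" "is_join P (a ` D) (J D)" "is_join P (a ` E) (J E)" for D E
      using that unfolding is_join_def by (meson image_mono subsetD)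
    have "B \<subseteq> C \<or> C \<subseteq> B"
      using level_weight_nonzero_comparable[OF fin nonneg] B C by auto
    then show "p \<le> q \<or> q \<le> p"
      using mono[of B C] mono[of C B] join[OF B(1,2)] join[OF C(1,2)] B(3) C(3) by auto
  qed
  moreover have "finite (nerve_vertices J Z)" using fin by (simp add: nerve_vertices_def)
  ultimately have "(\<lambda>p. if p \<in> nerve_vertices J Z
      then nerve_weight J Z u p / sum (nerve_weight J Z u) (nerve_vertices J Z) else 0)
    \<in> realization_points P"
    using q nerve_weight_nonneg[OF fin nonneg] by (intro realization_points_normalize)
  then show ?thesis by (simp add: nerve_point_def[abs_def])
qed

lemma nerve_point_support:
  assumes "finite Z" "\<forall>z\<in>Z. 0 \<le> u z" "nerve_point J Z u p \<noteq> 0"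
  obtains B where "B \<subseteq> {z \<in> Z. 0 < u z}" "B \<noteq> {}" "J B = p"
proof -
  have "nerve_weight J Z u p \<noteq> 0"
    using assms(3) by (auto simp: nerve_point_def split: if_splits)
  then show ?thesis
    by (rule nerve_weight_nonzero[of Z u J p, OF assms(1,2)]) (rule that)
qed

text \<open>Level weights are products of values of \<open>u\<close> and truncated differences, and
  the denominator stays positive because some \<open>u x z\<close> is positive.\<close>

lemma continuous_on_nerve_point:
  fixes u :: "'x::topological_space \<Rightarrow> 'z \<Rightarrow> real"
  assumes fin: "finite Z" and cont: "\<And>z. z \<in> Z \<Longrightarrow> continuous_on S (\<lambda>x. u x z)"
    and nonneg: "\<And>x. x \<in> S \<Longrightarrow> \<forall>z\<in>Z. 0 \<le> u x z"
    and pos: "\<And>x. x \<in> S \<Longrightarrow> \<exists>z\<in>Z. 0 < u x z"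
  shows "continuous_on S (\<lambda>x. nerve_point J Z (u x) p)"
proof -
  have "continuous_on S (\<lambda>x. level_weight Z (u x) B)" if "B \<subseteq> Z" for B
    unfolding level_weight_def using that by (intro continuous_intros cont) auto
  then have w: "continuous_on S (\<lambda>x. nerve_weight J Z (u x) q)" for q
    unfolding nerve_weight_def by (intro continuous_intros) auto
  have "sum (nerve_weight J Z (u x)) (nerve_vertices J Z) \<noteq> 0" if x: "x \<in> S" for x
  proof -
    obtain z where z: "z \<in> Z" "0 < u x z" using pos[OF x] by blast
    obtain q where q: "q \<in> nerve_vertices J Z" "0 < nerve_weight J Z (u x) q"
      using nerve_weight_pos_exists[where J=J, OF fin nonneg[OF x] z] by blast
    have "finite (nerve_vertices J Z)" using fin by (simp add: nerve_vertices_def)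
    then have "0 < sum (nerve_weight J Z (u x)) (nerve_vertices J Z)"
      using q nerve_weight_nonneg[OF fin nonneg[OF x]] by (intro sum_pos2)
    then show ?thesis by simp
  qed
  then show ?thesis
    unfolding nerve_point_def
    by (cases "p \<in> nerve_vertices J Z") (auto intro!: continuous_intros w)
qed

subsection \<open>Null-homotopy of maps from spheres\<close>

lemma nsphere_eq_top_of_set:
  "nsphere m = top_of_set {x. (\<Sum>i\<le>m. (x i)\<^sup>2) = 1 \<and> (\<forall>i>m. x i = 0)}"
  by (simp add: nsphere euclidean_product_topology)

lemma abs_nsphere_coordinate_le:
  fixes x :: "nat \<Rightarrow> real"
  assumes "(\<Sum>i\<le>m. (x i)\<^sup>2) = 1" "\<forall>i>m. x i = 0"
  shows "\<bar>x i\<bar> \<le> 1"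
proof (cases "i \<le> m")
  case True
  then have "(x i)\<^sup>2 \<le> (\<Sum>i\<le>m. (x i)\<^sup>2)" by (intro member_le_sum) auto
  then show ?thesis using assms(1) by (simp add: abs_square_le_1)
qed (use assms in auto)

text \<open>The sphere is a closed subset of a product of intervals, which is compact by
  Tychonoff.\<close>

lemma compact_nsphere:
  "compact {x :: nat \<Rightarrow> real. (\<Sum>i\<le>m. (x i)\<^sup>2) = 1 \<and> (\<forall>i>m. x i = 0)}" (is "compact ?S")
proof -
  have "compactin (powertop_real UNIV) (\<Pi>\<^sub>E i\<in>(UNIV::nat set). {-1..1})"
    by (simp add: compactin_PiE)
  then have K: "compact (\<Pi>\<^sub>E i\<in>(UNIV::nat set). {-1..1::real})"
    by (simp add: euclidean_product_topology)
  have C: "closed ?S"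
    by (intro closed_Collect_conj closed_Collect_all closed_Collect_imp open_Collect_const
        closed_Collect_eq continuous_intros continuous_on_product_coordinates)
  have "?S \<subseteq> (\<Pi>\<^sub>E i\<in>UNIV. {-1..1})"
  proof
    fix x assume "x \<in> ?S"
    then have "\<bar>x i\<bar> \<le> 1" for i by (intro abs_nsphere_coordinate_le[of _ m]) auto
    then show "x \<in> (\<Pi>\<^sub>E i\<in>UNIV. {-1..1})" by (auto simp: abs_le_iff minus_le_iff)
  qed
  then show ?thesis
    using compact_Int_closed[OF K C] by (simp only: Int_absorb1)
qed

text \<open>The metric on functions is controlled by finitely many coordinates up to an error
  \<open>(1/2) ^ N\<close>, which is made arbitrarily small.\<close>

lemma dist_fun_nat_le:
  fixes x y :: "nat \<Rightarrow> real"
  assumes "\<And>i. dist (x i) (y i) \<le> e"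
  shows "dist x y \<le> 2 * e"
proof (rule field_le_epsilon)
  fix d :: real assume "0 < d"
  then obtain N where N: "(1/2) ^ N < d"
    using real_arch_pow_inv[of d "1/2"] by auto
  have "Max {dist (x (from_nat i)) (y (from_nat i)) |i. i \<le> N} \<le> e"
    using assms by (subst Max_le_iff) auto
  then show "dist x y \<le> 2 * e + d"
    using dist_fun_le_dist_first_terms[of x y N] N by linarith
qed

text \<open>Two points of \<open>S\<close> in the same grid cube differ by at most
  \<open>2 / N\<close> in each coordinate, so the cube meets \<open>S\<close> in diameter at most
  \<open>4 / N\<close>. Any \<open>N\<close> above \<open>4 / d\<close>, with \<open>d\<close> a
  Lebesgue number, works for all \<open>z\<close> at once.\<close>

lemma grid_Lebesgue_number:
  fixes S :: "(nat \<Rightarrow> real) set"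
  assumes "compact S" and S: "\<forall>x\<in>S. \<forall>i\<ge>n. x i = 0"
    and cov: "\<D> \<noteq> {}" "S \<subseteq> \<Union>\<D>" "\<forall>B\<in>\<D>. open B"
  obtains N :: nat where
    "\<forall>z :: nat \<Rightarrow> int. \<exists>B\<in>\<D>. {x :: nat \<Rightarrow> real. x \<in> S \<and> (\<forall>i\<le>n. \<bar>N * x i - z i\<bar> \<le> 1)} \<subseteq> B"
proof -
  obtain d where d: "0 < d" "\<And>T. T \<subseteq> S \<Longrightarrow> diameter T < d \<Longrightarrow> \<exists>B\<in>\<D>. T \<subseteq> B"
    using Lebesgue_number_lemma[OF assms(1) cov(1,2)] cov(3) by metis
  obtain N :: nat where N: "4 / d < N" using reals_Archimedean2 by blast
  have "0 < 4 / d" using d(1) by simp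
  then have N0: "0 < real N" using N by linarith
  show ?thesis
  proof (rule that[of N], rule allI)
    fix z :: "nat \<Rightarrow> int"
    let ?T = "{x :: nat \<Rightarrow> real. x \<in> S \<and> (\<forall>i\<le>n. \<bar>N * x i - z i\<bar> \<le> 1)}"
    have dist: "dist x y \<le> 4 / N" if xy: "x \<in> ?T" "y \<in> ?T" for x y :: "nat \<Rightarrow> real"
    proof -
      have "dist (x i) (y i) \<le> 2 / N" for i
      proof (cases "i \<le> n")
        case True
        then have "\<bar>N * x i - z i\<bar> \<le> 1" "\<bar>N * y i - z i\<bar> \<le> 1" using xy by auto
        then have "\<bar>N * x i - N * y i\<bar> \<le> 2" by linarith
        then have "N * \<bar>x i - y i\<bar> \<le> 2"
          using abs_mult[of "real N" "x i - y i"] by (simp add: right_diff_distrib)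
        then show ?thesis using N0 by (simp add: dist_real_def pos_le_divide_eq mult.commute)
      next
        case False
        then have "x i = 0" "y i = 0" using xy S by auto
        then show ?thesis by simp
      qed
      from dist_fun_nat_le[OF this] show ?thesis by simp
    qed
    have "diameter ?T \<le> 4 / N"
    proof (cases "?T = {}")
      case False
      have "(SUP p\<in>?T \<times> ?T. case p of (x, y) \<Rightarrow> dist x y) \<le> 4 / N"
      proof (rule cSUP_least)
        show "?T \<times> ?T \<noteq> {}" using False by (simp only: Times_empty) blast
        show "(case p of (x, y) \<Rightarrow> dist x y) \<le> 4 / N" if "p \<in> ?T \<times> ?T" for p
          using that dist by (simp only: case_prod_beta mem_Times_iff)
      qed
      then show ?thesis unfolding diameter_def by (simp only: False if_False)
    next
      case True
      show ?thesis unfolding True by simp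
    qed
    also have "4 / N < d" using N N0 d(1) by (simp add: pos_divide_less_eq mult.commute)
    finally show "\<exists>B\<in>\<D>. ?T \<subseteq> B" by (rule d(2)[rotated]) blast
  qed
qed

lemma finite_int_box: "finite {z :: nat \<Rightarrow> int. (\<forall>i\<ge>n. z i = 0) \<and> (\<forall>i<n. \<bar>z i\<bar> \<le> M)}"
proof (rule finite_subset)
  show "{z. (\<forall>i\<ge>n. z i = 0) \<and> (\<forall>i<n. \<bar>z i\<bar> \<le> M)}
      \<subseteq> {z. \<forall>i. (i \<in> {..<n} \<longrightarrow> z i \<in> {-M..M}) \<and> (i \<notin> {..<n} \<longrightarrow> z i = 0)}"
    by (auto simp: abs_le_iff)
  show "finite {z :: nat \<Rightarrow> int. \<forall>i. (i \<in> {..<n} \<longrightarrow> z i \<in> {-M..M}) \<and> (i \<notin> {..<n} \<longrightarrow> z i = 0)}"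
    by (intro finite_set_of_finite_funs) auto
qed

lemma finite_chain_has_greatest:
  assumes "finite C" "C \<noteq> {}" "chain_in P C"
  obtains p where "p \<in> C" "\<forall>q\<in>C. q \<le> p"
proof -
  obtain p where p: "p \<in> C" "\<forall>q\<in>C. p \<le> q \<longrightarrow> p = q"
    using finite_has_maximal[OF assms(1,2)] by metis
  then show ?thesis
    using that assms(3) unfolding chain_in_def by metis
qed

lemma sphere_map_null_homotopic:
  fixes P :: "'a::order set"
  assumes at: "atomized P"
    and bdd: "\<And>T. finite T \<Longrightarrow> T \<subseteq> atoms P \<Longrightarrow> card T \<le> m + 2 \<Longrightarrow> has_upper_bound P T"
    and f: "continuous_map (nsphere m) (realization P) f"
  shows "\<exists>c \<in> realization_points P. homotopic_with (\<lambda>_. True) (nsphere m) (realization P) f (\<lambda>_. c)"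
proof -
  \<comment> \<open>The dimension of the ambient space of the sphere. Coordinate \<open>n\<close>
    vanishes on the sphere and serves as the homogeneous coordinate of \<open>hat\<close>.\<close>
  define n where "n = Suc m"
  define S :: "(nat \<Rightarrow> real) set" where "S = {x. (\<Sum>i\<le>m. (x i)\<^sup>2) = 1 \<and> (\<forall>i>m. x i = 0)}"
  have sphere: "nsphere m = top_of_set S" unfolding S_def by (rule nsphere_eq_top_of_set)
  have compS: "compact S" unfolding S_def by (rule compact_nsphere)
  \<comment> \<open>A cube stands in for the ball: it contains the sphere and all segments from it
    to the origin.\<close>
  define D where "D = {x :: nat \<Rightarrow> real. (\<forall>i\<ge>n. x i = 0) \<and> (\<forall>i. \<bar>x i\<bar> \<le> 1)}"
  have SD: "S \<subseteq> D"
    using abs_nsphere_coordinate_le by (auto simp: S_def D_def n_def Suc_le_eq)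
  have fP: "f x \<in> realization_points P" if "x \<in> S" for x
    using continuous_map_image_subset_topspace[OF f] that by (auto simp: sphere)
  have fcont: "continuous_on S (\<lambda>x. f x p)" for p
    using continuous_map_compose[OF f continuous_map_coordinate[of P p]]
    by (simp add: sphere o_def)
  \<comment> \<open>The image of the sphere is compact, so \<open>f\<close> uses only finitely many
    vertices.\<close>
  define V where "V = (\<Union>y\<in>f ` S. {p. y p \<noteq> 0})"
  have "compactin (nsphere m) S" using compS by (simp add: sphere)
  then have finV: "finite V"
    unfolding V_def using compactin_realization_finite_vertices[OF image_compactin[OF _ f]] by blast
  have fV: "{p. f x p \<noteq> 0} \<subseteq> V" if "x \<in> S" for x using that by (auto simp: V_def)
  have fpos: "0 \<le> f x p" if "x \<in> S" for x p
    using fP[OF that] by (simp add: realization_points_def)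
  have fchain: "finite {p. f x p \<noteq> 0}" "{p. f x p \<noteq> 0} \<noteq> {}" "chain_in P {p. f x p \<noteq> 0}"
    if "x \<in> S" for x
    using fP[OF that] by (auto simp: realization_points_def)

  \<comment> \<open>An upper bound of the empty set is an element of \<open>P\<close>, and some atom
    lies below it.\<close>
  have at_ne: "atoms P \<noteq> {}"
    using bdd[of "{}"] at by (auto simp: has_upper_bound_def atomized_def)
  \<comment> \<open>The Lebesgue number lemma needs open sets of the ambient metric space, so the
    relatively open sets are extended beyond \<open>S\<close>.\<close>
  have "\<exists>U. open U \<and> S \<inter> U = {x \<in> S. \<exists>p\<in>{p. b \<le> p}. 0 < f x p}" for b
  proof -
    let ?O = "{y \<in> realization_points P. \<exists>p\<in>{p. b \<le> p}. 0 < y p}"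
    have "openin (top_of_set S) {x \<in> topspace (nsphere m). f x \<in> ?O}"
      unfolding sphere[symmetric]
      by (intro openin_continuous_map_preimage[OF f] openin_realization_Collect
          open_Collect_pos_coordinate)
    moreover have "{x \<in> topspace (nsphere m). f x \<in> ?O} = {x \<in> S. \<exists>p\<in>{p. b \<le> p}. 0 < f x p}"
      using fP by (auto simp: sphere)
    ultimately show ?thesis unfolding openin_open by auto
  qed
  then have "\<forall>b. \<exists>U. open U \<and> S \<inter> U = {x \<in> S. \<exists>p\<in>{p. b \<le> p}. 0 < f x p}" by (rule allI)
  from choice[OF this] obtain U where
    "\<forall>b. open (U b) \<and> S \<inter> U b = {x \<in> S. \<exists>p\<in>{p. b \<le> p}. 0 < f x p}" ..
  then have U: "\<And>b. open (U b)" "\<And>b. S \<inter> U b = {x \<in> S. \<exists>p\<in>{p. b \<le> p}. 0 < f x p}"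
    by simp_all
  have cov: "S \<subseteq> \<Union>(U ` atoms P)"
  proof
    fix x assume x: "x \<in> S"
    obtain p where p: "f x p \<noteq> 0" using fchain(2)[OF x] by blast
    then have "p \<in> P" using fchain(3)[OF x] by (auto simp: chain_in_def)
    then obtain b where "b \<in> atoms P" "b \<le> p" using at by (auto simp: atomized_def)
    moreover have "0 < f x p" using p fpos[OF x, of p] by simp
    ultimately show "x \<in> \<Union>(U ` atoms P)" using U(2)[of b] x by auto
  qed
  have S0: "\<forall>x\<in>S. \<forall>i\<ge>n. x i = 0" using SD by (auto simp: D_def)
  have U': "U ` atoms P \<noteq> {}" "\<forall>B\<in>U ` atoms P. open B" using at_ne U(1) by auto
  obtain N :: nat where N: "\<forall>z :: nat \<Rightarrow> int.
      \<exists>B\<in>U ` atoms P. {x :: nat \<Rightarrow> real. x \<in> S \<and> (\<forall>i\<le>n. \<bar>N * x i - z i\<bar> \<le> 1)} \<subseteq> B"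
    by (rule grid_Lebesgue_number[OF compS S0 U'(1) cov U'(2)])
  define near where "near = (\<lambda>(z :: nat \<Rightarrow> int) (x :: nat \<Rightarrow> real). \<forall>i\<le>n. \<bar>N * x i - real_of_int (z i)\<bar> \<le> 1)"
  \<comment> \<open>If no point of \<open>S\<close> is near \<open>z\<close>, the condition is void;
    such lattice points still need an atom because \<open>G\<close> is defined on all of
    \<open>D\<close>.\<close>
  have "\<forall>z. \<exists>b. b \<in> atoms P \<and> (\<forall>x\<in>S. near z x \<longrightarrow> (\<exists>p. b \<le> p \<and> 0 < f x p))"
  proof
    fix z :: "nat \<Rightarrow> int"
    obtain b where b: "b \<in> atoms P" "{x :: nat \<Rightarrow> real. x \<in> S \<and> (\<forall>i\<le>n. \<bar>N * x i - z i\<bar> \<le> 1)} \<subseteq> U b"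
      using N by blast
    have "\<exists>p. b \<le> p \<and> 0 < f x p" if "x \<in> S" "near z x" for x
    proof -
      have "x \<in> S \<inter> U b" using that b(2) unfolding near_def by blast
      then show ?thesis using U(2)[of b] by blast
    qed
    then show "\<exists>b. b \<in> atoms P \<and> (\<forall>x\<in>S. near z x \<longrightarrow> (\<exists>p. b \<le> p \<and> 0 < f x p))"
      using b(1) by blast
  qed
  from choice[OF this] obtain a where
    "\<forall>z. a z \<in> atoms P \<and> (\<forall>x\<in>S. near z x \<longrightarrow> (\<exists>p. a z \<le> p \<and> 0 < f x p))" ..
  then have a: "\<And>z. a z \<in> atoms P"
    "\<And>z x. x \<in> S \<Longrightarrow> near z x \<Longrightarrow> \<exists>p. a z \<le> p \<and> 0 < f x p"
    by blast+

  define Z where "Z = {z :: nat \<Rightarrow> int. (\<forall>i\<ge>n. z i = 0) \<and> (\<forall>i<n. \<bar>z i\<bar> \<le> int N)}"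
  have finZ: "finite Z" unfolding Z_def by (rule finite_int_box)
  define u where "u = (\<lambda>(x :: nat \<Rightarrow> real) (z :: nat \<Rightarrow> int). hat n z (\<lambda>i. real N * x i))"
  define J where "J = (\<lambda>B. SOME j. is_join P (a ` B) j)"
  have u0: "\<forall>z\<in>Z. 0 \<le> u x z" for x by (simp add: u_def hat_nonneg)
  have ex_u: "\<exists>z\<in>Z. 0 < u x z" if x: "x \<in> D" for x
  proof (rule bexI[of _ "\<lambda>i. \<lfloor>N * x i\<rfloor>"])
    show "0 < u x (\<lambda>i. \<lfloor>N * x i\<rfloor>)" unfolding u_def by (rule hat_floor_pos)
    have "\<bar>\<lfloor>N * x i\<rfloor>\<bar> \<le> int N" for i
    proof -
      have "\<bar>N * x i\<bar> \<le> real N * 1"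
        unfolding abs_mult using x by (intro mult_mono) (auto simp: D_def)
      then have "-real N \<le> N * x i" "N * x i \<le> real N" by (auto simp: abs_le_iff)
      then show ?thesis by linarith
    qed
    then show "(\<lambda>i. \<lfloor>N * x i\<rfloor>) \<in> Z" using x by (auto simp: Z_def D_def)
  qed
  have join: "is_join P (a ` B) (J B)" if x: "x \<in> D" and B: "B \<subseteq> {z \<in> Z. 0 < u x z}" "B \<noteq> {}" for x B
  proof -
    have "finite B" by (rule finite_subset[OF _ finZ]) (use B(1) in blast)
    \<comment> \<open>At most \<open>n + 1 = m + 2\<close> stars meet at a point, which is exactly
      the number of atoms that \<open>bdd\<close> admits.\<close>
    have "card B \<le> Suc n"
      by (rule card_hat_pos[of "\<lambda>i. N * x i"])
        (use x B(1) in \<open>auto simp: D_def u_def Z_def\<close>)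
    then have "card (a ` B) \<le> m + 2"
      using card_image_le[OF \<open>finite B\<close>, of a] by (simp add: n_def)
    then have "has_upper_bound P (a ` B)"
      using a(1) \<open>finite B\<close> by (intro bdd) auto
    then have "\<exists>j. is_join P (a ` B) j"
      using at a(1) \<open>finite B\<close> B(2) unfolding atomized_def by blast
    then show ?thesis unfolding J_def by (rule someI_ex)
  qed
  define G where "G = (\<lambda>x. nerve_point J Z (u x))"
  have GP: "G x \<in> realization_points P" if x: "x \<in> D" for x
    using ex_u[OF x] nerve_point_in_realization[OF finZ u0 _ _ join[OF x]] by (auto simp: G_def)
  have Gsupp: "\<exists>B. B \<subseteq> {z \<in> Z. 0 < u x z} \<and> B \<noteq> {} \<and> J B = p" if "G x p \<noteq> 0" for x p
    using nerve_point_support[OF finZ u0 that[unfolded G_def]] by metis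
  have GV: "{p. G x p \<noteq> 0} \<subseteq> nerve_vertices J Z" for x
    by (auto simp: G_def nerve_point_def)
  have finJ: "finite (nerve_vertices J Z)" using finZ by (simp add: nerve_vertices_def)
  have Gcont: "continuous_on D (\<lambda>x. G x p)" for p
    unfolding G_def
  proof (rule continuous_on_nerve_point[OF finZ _ u0 ex_u])
    show "continuous_on D (\<lambda>x. u x z)" for z
      unfolding u_def hat_def
      by (intro continuous_intros continuous_on_product_then_coordinatewise[OF continuous_on_id])
  qed

  \<comment> \<open>Damping factors: continuous in \<open>x\<close> and zero exactly when
    \<open>near z x\<close>.\<close>
  define \<psi> where "\<psi> = (\<lambda>(x :: nat \<Rightarrow> real) (z :: nat \<Rightarrow> int). \<Sum>i\<le>n. max 0 (\<bar>N * x i - real_of_int (z i)\<bar> - 1))"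
  have \<psi>0: "0 \<le> \<psi> x z" for x z by (auto simp: \<psi>_def intro: sum_nonneg)
  have \<psi>_zero: "\<psi> x z = 0 \<longleftrightarrow> near z x" for x z
  proof -
    have "max 0 (r - 1) = 0 \<longleftrightarrow> r \<le> 1" for r :: real by (auto simp: max_def)
    then show ?thesis
      unfolding \<psi>_def near_def by (subst sum_nonneg_eq_0_iff) auto
  qed
  define w where "w = (\<lambda>x p. f x p * (\<Prod>z | z \<in> Z \<and> \<not> a z \<le> p. \<psi> x z))"
  have w0: "0 \<le> w x p" if "x \<in> S" for x p
    using fpos[OF that] \<psi>0 by (auto simp: w_def intro!: mult_nonneg_nonneg prod_nonneg)
  have wf: "f x p \<noteq> 0" if "w x p \<noteq> 0" for x p using that by (auto simp: w_def)
  have ex_w: "\<exists>p\<in>V. 0 < w x p" if x: "x \<in> S" for x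
  proof -
    obtain p where "p \<in> {p. f x p \<noteq> 0}" "\<forall>q\<in>{p. f x p \<noteq> 0}. q \<le> p"
      by (rule finite_chain_has_greatest[OF fchain[OF x]])
    then have p: "f x p \<noteq> 0" "\<And>q. f x q \<noteq> 0 \<Longrightarrow> q \<le> p" by simp_all
    \<comment> \<open>If \<open>z\<close> were near \<open>x\<close>, some vertex of the carrier
      would lie above \<open>a z\<close>, and the greatest vertex \<open>p\<close> lies above that
      one.\<close>
    have "\<psi> x z \<noteq> 0" if "\<not> a z \<le> p" for z
      using a(2)[OF x, of z] p(2) that \<psi>_zero[of x z] by (metis less_irrefl order_trans)
    then have "0 < w x p"
      unfolding w_def using p(1) fpos[OF x, of p] \<psi>0
      by (intro mult_pos_pos prod_pos) (auto simp: less_le)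
    then show ?thesis using fV[OF x] p(1) by blast
  qed
  \<comment> \<open>A positive hat function puts \<open>z\<close> near \<open>x\<close>, so a vertex
    not above \<open>a z\<close> has a zero damping factor.\<close>
  have w_above: "a z \<le> p" if x: "x \<in> D" and z: "z \<in> Z" "0 < u x z" and "w x p \<noteq> 0" for x z p
  proof (rule ccontr)
    assume "\<not> a z \<le> p"
    moreover have "\<psi> x z = 0"
      unfolding \<psi>_zero near_def
    proof (intro allI impI)
      fix i assume "i \<le> n"
      then show "\<bar>N * x i - real_of_int (z i)\<bar> \<le> 1"
        using hat_pos_imp_near[of n z "\<lambda>i. N * x i" i] x z by (auto simp: u_def D_def Z_def)
    qed
    ultimately show False
      using \<open>w x p \<noteq> 0\<close> z(1) finZ by (auto simp: w_def prod_zero_iff)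
  qed
  define f' where "f' = (\<lambda>x p. if p \<in> V then w x p / sum (w x) V else 0)"
  have sumw: "sum (w x) V \<noteq> 0" if x: "x \<in> S" for x
  proof -
    obtain p where "p \<in> V" "0 < w x p" using ex_w[OF x] by blast
    then have "0 < sum (w x) V" using finV w0[OF x] by (intro sum_pos2)
    then show ?thesis by simp
  qed
  have f'w: "w x p \<noteq> 0" if "f' x p \<noteq> 0" for x p using that by (auto simp: f'_def split: if_splits)
  have f'P: "f' x \<in> realization_points P" if x: "x \<in> S" for x
  proof -
    obtain p where "p \<in> V" "0 < w x p" using ex_w[OF x] by blast
    moreover have "chain_in P {p \<in> V. w x p \<noteq> 0}"
      by (rule chain_in_subset[OF fchain(3)[OF x]]) (auto dest: wf)
    ultimately show ?thesis
      unfolding f'_def using finV w0[OF x] by (intro realization_points_normalize)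
  qed
  have f'V: "{p. f' x p \<noteq> 0} \<subseteq> V" for x by (auto simp: f'_def)
  have f'cont: "continuous_on S (\<lambda>x. f' x p)" for p
  proof -
    have "continuous_on S (\<lambda>x. w x p)" for p
      unfolding w_def \<psi>_def
      by (intro continuous_intros continuous_on_product_then_coordinatewise[OF continuous_on_id] fcont)
    then show ?thesis
      unfolding f'_def using sumw by (cases "p \<in> V") (auto intro!: continuous_intros)
  qed

  have 1: "homotopic_with (\<lambda>_. True) (top_of_set S) (realization P) f f'"
  proof (rule homotopic_into_realization[OF finV fP fV fcont f'P f'V f'cont])
    fix x assume x: "x \<in> S"
    \<comment> \<open>Damping only removes vertices, so the union is the support of
      \<open>f x\<close>.\<close>
    show "chain_in P ({p. f x p \<noteq> 0} \<union> {p. f' x p \<noteq> 0})"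
      by (rule chain_in_subset[OF fchain(3)[OF x]]) (auto dest: f'w wf)
  qed
  have 2: "homotopic_with (\<lambda>_. True) (top_of_set S) (realization P) f' G"
  proof (rule homotopic_into_realization[of "V \<union> nerve_vertices J Z"])
    show "finite (V \<union> nerve_vertices J Z)" using finV finJ by simp
    show "continuous_on S (\<lambda>x. G x p)" for p using Gcont SD continuous_on_subset by blast
    fix x assume x: "x \<in> S"
    then have xD: "x \<in> D" using SD by blast
    show "G x \<in> realization_points P" by (rule GP[OF xD])
    \<comment> \<open>The vertex \<open>q\<close> of \<open>G x\<close> is a join of atoms that all
      lie below the surviving vertex \<open>p\<close>. Thus the chain of \<open>G x\<close> lies
      below that of \<open>f' x\<close>.\<close>
    have "q \<le> p" if p: "f' x p \<noteq> 0" and q: "G x q \<noteq> 0" for p q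
    proof -
      obtain B where B: "B \<subseteq> {z \<in> Z. 0 < u x z}" "B \<noteq> {}" "J B = q"
        using Gsupp[OF q] by blast
      have "\<forall>s\<in>a ` B. s \<le> p" using w_above[OF xD _ _ f'w[OF p]] B(1) by auto
      moreover have "p \<in> P" using f'P[OF x] p by (auto simp: realization_points_def chain_in_def)
      ultimately show ?thesis using join[OF xD B(1,2)] B(3) by (auto simp: is_join_def)
    qed
    moreover have "chain_in P {p. f' x p \<noteq> 0}" "chain_in P {p. G x p \<noteq> 0}"
      using f'P[OF x] GP[OF xD] by (auto simp: realization_points_def)
    ultimately show "chain_in P ({p. f' x p \<noteq> 0} \<union> {p. G x p \<noteq> 0})"
      by (auto simp: chain_in_def)
    show "f' x \<in> realization_points P" by (rule f'P[OF x])
    show "{p. f' x p \<noteq> 0} \<subseteq> V \<union> nerve_vertices J Z" using f'V by blast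
    show "{p. G x p \<noteq> 0} \<subseteq> V \<union> nerve_vertices J Z" using GV by blast
  qed (rule f'cont)
  have 3: "homotopic_with (\<lambda>_. True) (top_of_set S) (realization P) G (\<lambda>_. G (\<lambda>_. 0))"
  proof -
    \<comment> \<open>Since \<open>G\<close> is defined on the whole cube, the radial contraction of
      the sphere to the origin can be followed by \<open>G\<close>.\<close>
    define h where "h = (\<lambda>(t::real, x::nat \<Rightarrow> real). G (\<lambda>i. (1 - t) * x i))"
    have inD: "(\<lambda>i. (1 - t) * x i) \<in> D" if "t \<in> {0..1}" "x \<in> S" for t x
    proof -
      have "\<bar>(1 - t) * x i\<bar> \<le> 1 * 1" for i
        unfolding abs_mult using that SD by (intro mult_mono) (auto simp: D_def)
      then show ?thesis using that SD by (auto simp: D_def)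
    qed
    have "continuous_map (top_of_set ({0..1} \<times> S)) (realization P) h"
    proof (rule continuous_map_into_realization[OF finJ])
      fix y :: "real \<times> (nat \<Rightarrow> real)" assume "y \<in> {0..1} \<times> S"
      then show "h y \<in> realization_points P" using inD GP by (auto simp: h_def)
      show "{p. h y p \<noteq> 0} \<subseteq> nerve_vertices J Z"
        unfolding h_def case_prod_beta by (rule GV)
    next
      fix p
      have "continuous_on ({0..1} \<times> S) (\<lambda>y :: real \<times> (nat \<Rightarrow> real). (\<lambda>i. (1 - fst y) * snd y i))"
      proof (rule continuous_on_coordinatewise_then_product)
        fix i
        have "continuous_on ({0..1} \<times> S) (\<lambda>y :: real \<times> (nat \<Rightarrow> real). snd y i)"
          by (rule continuous_on_product_then_coordinatewise[OF continuous_on_snd[OF continuous_on_id]])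
        then show "continuous_on ({0..1} \<times> S) (\<lambda>y. (1 - fst y) * snd y i)"
          by (intro continuous_on_mult continuous_on_diff continuous_on_const continuous_on_fst
              continuous_on_id)
      qed
      then have "continuous_on ({0..1} \<times> S) (\<lambda>y. G (\<lambda>i. (1 - fst y) * snd y i) p)"
        by (rule continuous_on_compose2[OF Gcont]) (use inD in auto)
      then show "continuous_on ({0..1} \<times> S) (\<lambda>y. h y p)"
        by (simp add: h_def case_prod_beta)
    qed
    then show ?thesis
      unfolding homotopic_with_def by (intro exI[of _ h]) (auto simp: h_def)
  qed
  have h: "homotopic_with (\<lambda>_. True) (nsphere m) (realization P) f (\<lambda>_. G (\<lambda>_. 0))"
    unfolding sphere by (rule homotopic_with_trans[OF homotopic_with_trans[OF 1 2] 3])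
  have D0: "(\<lambda>_. 0) \<in> D" unfolding D_def by simp
  show ?thesis using GP[OF D0] h by metis
qed

corollary atomized_n_connected:
  fixes P :: "'a::order set"
  assumes at: "atomized P"
    and bdd: "\<And>T. finite T \<Longrightarrow> T \<subseteq> atoms P \<Longrightarrow> card T \<le> k \<Longrightarrow> has_upper_bound P T"
  shows "n_connected (int k - 2) (realization P)"
  unfolding n_connected_def topspace_realization
proof (intro conjI impI allI)
  \<comment> \<open>The empty set of atoms has an upper bound, so \<open>P\<close> is
    nonempty.\<close>
  obtain p where p: "p \<in> P" using bdd[of "{}"] by (auto simp: has_upper_bound_def)
  have "(\<lambda>x. if x = p then 1 else 0) \<in> realization_points P"
    by (rule realization_pointsI[of "{p}"]) (use p in \<open>auto simp: chain_in_def\<close>)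
  then show "realization_points P \<noteq> {}" by blast
  fix m :: nat and f
  assume m: "int m \<le> int k - 2" and f: "continuous_map (nsphere m) (realization P) f"
  show "\<exists>c\<in>realization_points P. homotopic_with (\<lambda>_. True) (nsphere m) (realization P) f (\<lambda>_. c)"
    by (rule sphere_map_null_homotopic[OF at bdd f]) (use m in auto)
qed

subsection \<open>Coset posets and subgroup posets\<close>

context group
begin

section \<open>Joins and atoms in the coset poset\<close>

lemma mem_l_coset_iff:
  assumes "subgroup H G" "x \<in> carrier G" "y \<in> carrier G"
  shows "y \<in> x <# H \<longleftrightarrow> inv x \<otimes> y \<in> H"
proof
  assume "y \<in> x <# H"
  then obtain h where h: "h \<in> H" "y = x \<otimes> h" by (auto simp: l_coset_def)
  moreover have "h \<in> carrier G" using h assms(1) by (meson subgroup.mem_carrier)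
  ultimately show "inv x \<otimes> y \<in> H" using assms(2) by (simp add: m_assoc[symmetric])
next
  assume h: "inv x \<otimes> y \<in> H"
  have "y = x \<otimes> (inv x \<otimes> y)" using assms by (simp add: m_assoc[symmetric])
  then show "y \<in> x <# H" using h unfolding l_coset_def by blast
qed

text \<open>Every element of a coset represents it, so the representative can later be taken from a
  given set of points.\<close>

lemma coset_posetE:
  assumes "u \<in> coset_poset G"
  obtains H where "subgroup H G" "H \<noteq> carrier G" "u \<subseteq> carrier G" "u \<noteq> {}"
    "\<And>x. x \<in> u \<Longrightarrow> u = x <# H"
proof -
  obtain y H where y: "u = y <# H" "y \<in> carrier G" "subgroup H G" "H \<noteq> carrier G"
    using assms unfolding coset_poset_def by blast
  have "u \<subseteq> carrier G"
    using y l_coset_subset_G subgroup.subset by metis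
  moreover have "\<one> \<in> H" using y(3) by (rule subgroup.one_closed)
  then have "u \<noteq> {}" using y(1) unfolding l_coset_def by blast
  moreover have "u = x <# H" if "x \<in> u" for x
    using l_repr_independence[of x y H] that y by simp
  ultimately show ?thesis using that y by blast
qed

lemma singleton_in_coset_poset:
  assumes "carrier G \<noteq> {\<one>}" "x \<in> carrier G"
  shows "{x} \<in> coset_poset G"
proof -
  have "{x} = x <# {\<one>}" using assms(2) by (simp add: l_coset_def)
  then show ?thesis
    using assms triv_subgroup unfolding coset_poset_def by auto
qed

text \<open>Singletons are the cosets of the trivial subgroup, which is proper here. Cosets are
  nonempty, so nothing lies strictly below a singleton.\<close>

lemma atoms_coset_poset:
  assumes "carrier G \<noteq> {\<one>}"
  shows "atoms (coset_poset G) = (\<lambda>x. {x}) ` carrier G"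
proof (rule equalityI; rule subsetI)
  fix a assume a: "a \<in> atoms (coset_poset G)"
  then have aP: "a \<in> coset_poset G" by (simp add: atoms_def)
  obtain x where x: "x \<in> a" "x \<in> carrier G" using aP by (rule coset_posetE) blast
  have "\<not> {x} \<subset> a"
    using a singleton_in_coset_poset[OF assms x(2)] by (simp add: atoms_def)
  then have "a = {x}" using x(1) by blast
  then show "a \<in> (\<lambda>x. {x}) ` carrier G" using x(2) by simp
next
  fix a assume "a \<in> (\<lambda>x. {x}) ` carrier G"
  then obtain x where x: "a = {x}" "x \<in> carrier G" by blast
  have "\<not> b \<subset> {x}" if "b \<in> coset_poset G" for b
    using that by (rule coset_posetE) blast
  then show "a \<in> atoms (coset_poset G)"
    using x singleton_in_coset_poset[OF assms x(2)] by (simp add: atoms_def)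
qed

text \<open>For \<open>x \<in> T\<close> this is the smallest coset containing \<open>T\<close>.
  Translation by \<open>inv x\<close> sends \<open>x\<close> to the identity, so \<open>x\<close> is
  dropped and one generator is saved.\<close>

definition coset_span :: "'a \<Rightarrow> 'a set \<Rightarrow> 'a set" where
  "coset_span x T = x <# generate G ((\<lambda>y. inv x \<otimes> y) ` (T - {x}))"

lemma coset_span:
  assumes T: "T \<subseteq> carrier G" and x: "x \<in> T"
  shows "T \<subseteq> coset_span x T"
    and "\<And>u. u \<in> coset_poset G \<Longrightarrow> T \<subseteq> u \<Longrightarrow> coset_span x T \<subseteq> u \<and> coset_span x T \<in> coset_poset G"
    and "generate G ((\<lambda>y. inv x \<otimes> y) ` (T - {x})) \<noteq> carrier G \<Longrightarrow> coset_span x T \<in> coset_poset G"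
proof -
  let ?g = "(\<lambda>y. inv x \<otimes> y) ` (T - {x})"
  have xc: "x \<in> carrier G" using assms by blast
  have gc: "?g \<subseteq> carrier G" using T xc by auto
  have sub: "subgroup (generate G ?g) G" by (rule generate_is_subgroup[OF gc])
  show "T \<subseteq> coset_span x T"
  proof
    fix y assume y: "y \<in> T"
    then have yc: "y \<in> carrier G" using T by blast
    have "inv x \<otimes> y \<in> generate G ?g"
    proof (cases "y = x")
      case True
      then show ?thesis using xc by (simp add: generate.one)
    next
      case False
      then show ?thesis using y by (intro generate.incl) blast
    qed
    then show "y \<in> coset_span x T"
      unfolding coset_span_def mem_l_coset_iff[OF sub xc yc] .
  qed
  show P: "coset_span x T \<in> coset_poset G" if "generate G ?g \<noteq> carrier G"
    using that sub xc unfolding coset_span_def coset_poset_def by blast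
  show "coset_span x T \<subseteq> u \<and> coset_span x T \<in> coset_poset G"
    if u: "u \<in> coset_poset G" and Tu: "T \<subseteq> u" for u
  proof -
    obtain H where H: "subgroup H G" "H \<noteq> carrier G" "\<And>x. x \<in> u \<Longrightarrow> u = x <# H"
      using u by (rule coset_posetE) blast
    have uH: "u = x <# H" using H(3) x Tu by blast
    \<comment> \<open>Translating \<open>u\<close> by \<open>inv x\<close> yields the subgroup
      \<open>H\<close>, which therefore contains all translated points of \<open>T\<close>.\<close>
    have "?g \<subseteq> H"
    proof
      fix h assume "h \<in> ?g"
      then obtain y where y: "y \<in> T" "h = inv x \<otimes> y" by blast
      have "y \<in> carrier G" "y \<in> x <# H" using y(1) T Tu uH by auto
      then show "h \<in> H" using mem_l_coset_iff[OF H(1) xc] y(2) by simp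
    qed
    then have gH: "generate G ?g \<subseteq> H" using H(1) by (rule generate_subgroup_incl)
    have "generate G ?g \<noteq> carrier G"
      using gH H(2) subgroup.subset[OF H(1)] by blast
    moreover have "coset_span x T \<subseteq> u"
      unfolding coset_span_def uH l_coset_def using gH by blast
    ultimately show ?thesis using P by blast
  qed
qed

lemma atoms_coset_poset_Union:
  assumes "carrier G \<noteq> {\<one>}" "S \<subseteq> atoms (coset_poset G)"
  shows "\<Union>S \<subseteq> carrier G" "S = (\<lambda>x. {x}) ` \<Union>S"
  using assms(2) unfolding atoms_coset_poset[OF assms(1)] by (blast, force)

lemma atomized_coset_poset:
  assumes ne: "carrier G \<noteq> {\<one>}"
  shows "atomized (coset_poset G)"
  unfolding atomized_def
proof (intro conjI ballI allI impI)
  fix u assume "u \<in> coset_poset G"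
  then obtain x where "x \<in> u" "x \<in> carrier G" by (rule coset_posetE) blast
  then show "\<exists>a\<in>atoms (coset_poset G). a \<subseteq> u"
    unfolding atoms_coset_poset[OF ne] by blast
next
  fix S assume S: "finite S \<and> S \<noteq> {} \<and> S \<subseteq> atoms (coset_poset G) \<and> has_upper_bound (coset_poset G) S"
  define T where "T = \<Union>S"
  have T: "T \<subseteq> carrier G" "S = (\<lambda>x. {x}) ` T"
    using atoms_coset_poset_Union[OF ne] S unfolding T_def by blast+
  obtain x where x: "x \<in> T" using S T(2) by blast
  have iff: "(\<forall>s\<in>S. s \<subseteq> u) \<longleftrightarrow> T \<subseteq> u" for u unfolding T_def by blast
  obtain u where "u \<in> coset_poset G" "T \<subseteq> u"
    using S unfolding has_upper_bound_def iff by blast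
  then have "is_join (coset_poset G) S (coset_span x T)"
    unfolding is_join_def iff using coset_span[OF T(1) x] by blast
  then show "\<exists>j. is_join (coset_poset G) S j" ..
qed

text \<open>\<open>k + 1\<close> singletons need only \<open>k\<close> generators after translation.
  This shift accounts for the extra degree of connectivity of the coset poset.\<close>

lemma coset_poset_has_upper_bound:
  assumes gen: "\<And>T. T \<subseteq> carrier G \<Longrightarrow> finite T \<Longrightarrow> card T \<le> k \<Longrightarrow> generate G T \<noteq> carrier G"
    and S: "finite S" "S \<subseteq> atoms (coset_poset G)" "card S \<le> Suc k"
  shows "has_upper_bound (coset_poset G) S"
proof -
  \<comment> \<open>The empty set generates the trivial subgroup, so \<open>gen\<close> makes
    \<open>G\<close> nontrivial.\<close>
  have ne: "carrier G \<noteq> {\<one>}" using gen[of "{}"] generate_empty by simp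
  show ?thesis
  proof (cases "S = {}")
    case True
    then show ?thesis
      unfolding has_upper_bound_def using singleton_in_coset_poset[OF ne one_closed] by blast
  next
    case False
    define T where "T = \<Union>S"
    have T: "T \<subseteq> carrier G" "S = (\<lambda>x. {x}) ` T"
      using atoms_coset_poset_Union[OF ne S(2)] unfolding T_def by blast+
    obtain x where x: "x \<in> T" using False T(2) by blast
    have inj: "inj_on (\<lambda>x. {x}) T" by simp
    have finT: "finite T" using S(1) T(2) inj finite_imageD by metis
    have "card S = card T" using card_image[OF inj] T(2) by simp
    then have "card (T - {x}) \<le> k" using S(3) x finT by (simp add: card_Diff_singleton)
    then have "card ((\<lambda>y. inv x \<otimes> y) ` (T - {x})) \<le> k"
      using card_image_le[of "T - {x}" "\<lambda>y. inv x \<otimes> y"] finT by simp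
    moreover have "(\<lambda>y. inv x \<otimes> y) ` (T - {x}) \<subseteq> carrier G" using T(1) x by auto
    ultimately have "generate G ((\<lambda>y. inv x \<otimes> y) ` (T - {x})) \<noteq> carrier G"
      using finT by (intro gen) auto
    then have "coset_span x T \<in> coset_poset G" by (rule coset_span(3)[OF T(1) x])
    moreover have "\<forall>s\<in>S. s \<subseteq> coset_span x T"
      using coset_span(1)[OF T(1) x] unfolding T_def by blast
    ultimately show ?thesis unfolding has_upper_bound_def by blast
  qed
qed

section \<open>Subgroups of prime order and the subgroup poset of a torsion group\<close>

lemma ord_dvd_of_mem_generate:
  assumes "y \<in> carrier G" "z \<in> generate G {y}"
  shows "ord z dvd ord y"
proof -
  obtain i :: int where z: "z = y [^] i" using assms generate_pow[OF assms(1)] by blast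
  have "z [^] ord y = y [^] (i * int (ord y))"
    using assms(1) by (simp add: z int_pow_pow flip: int_pow_int)
  also have "\<dots> = \<one>" using assms(1) by (simp add: int_pow_eq_id)
  finally show ?thesis using pow_eq_id z assms(1) by simp
qed

text \<open>If a nontrivial \<open>x\<close> has order \<open>p * q\<close> with \<open>p\<close>
  prime, then \<open>x [^] q\<close> has order \<open>p\<close>.\<close>

lemma torsion_ex_prime_ord:
  assumes tors: "torsion_group G" and H: "subgroup H G" "H \<noteq> {\<one>}"
  shows "\<exists>y\<in>H. Factorial_Ring.prime (ord y)"
proof -
  obtain x where x: "x \<in> H" "x \<noteq> \<one>" using H subgroup.one_closed by blast
  have xc: "x \<in> carrier G" using x(1) H(1) by (meson subgroup.mem_carrier)
  obtain n :: nat where "n > 0" "x [^] n = \<one>" using tors xc unfolding torsion_group_def by blast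
  \<comment> \<open>Order 0 encodes infinite order, which torsion excludes.\<close>
  then have ord0: "ord x \<noteq> 0" using xc ord_eq_0 by auto
  have "ord x \<noteq> 1" using ord_eq_1 xc x(2) by simp
  then obtain p where p: "Factorial_Ring.prime p" "p dvd ord x"
    using prime_factor_nat by blast
  then obtain q where q: "ord x = p * q" by (elim dvdE)
  then have "q \<noteq> 0" using ord0 by auto
  then have "ord (x [^] q) = p" using ord_pow[OF xc, of q] q by simp
  moreover have "x [^] q \<in> H"
    using x(1) H(1) by (induction q) (auto simp: subgroup.one_closed subgroup.m_closed)
  ultimately show ?thesis using p(1) by blast
qed

text \<open>A nontrivial element of a subgroup of prime order has the same order and so generates
  all of it. Containment in \<open>H\<close> shows that the subgroup is proper in
  \<open>G\<close>.\<close>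

lemma generate_prime_ord_in_atoms:
  assumes y: "y \<in> carrier G" "Factorial_Ring.prime (ord y)"
    and H: "H \<in> subgroup_poset G" "y \<in> H"
  shows "generate G {y} \<in> atoms (subgroup_poset G)" "generate G {y} \<subseteq> H"
proof -
  have sub: "subgroup (generate G {y}) G" using y(1) by (intro generate_is_subgroup) simp
  have yg: "y \<in> generate G {y}" by (simp add: generate.incl)
  have y1: "y \<noteq> \<one>" using y(2) by auto
  show gH: "generate G {y} \<subseteq> H"
    using H by (intro generate_subgroup_incl) (auto simp: subgroup_poset_def)
  have "H \<subseteq> carrier G" "H \<noteq> carrier G"
    using H(1) by (auto simp: subgroup_poset_def dest: subgroup.subset)
  then have "generate G {y} \<in> subgroup_poset G"
    using sub yg y1 gH unfolding subgroup_poset_def by blast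
  moreover have "\<not> K \<subset> generate G {y}" if K: "K \<in> subgroup_poset G" for K
  proof
    assume Ky: "K \<subset> generate G {y}"
    have Ks: "subgroup K G" "K \<noteq> {\<one>}" using K by (auto simp: subgroup_poset_def)
    obtain z where z: "z \<in> K" "z \<noteq> \<one>" using Ks subgroup.one_closed by blast
    have zc: "z \<in> carrier G" using z(1) Ks(1) by (meson subgroup.mem_carrier)
    have "ord z dvd ord y" using ord_dvd_of_mem_generate[OF y(1)] z(1) Ky by blast
    moreover have "ord z \<noteq> 1" using ord_eq_1[OF zc] z(2) by simp
    ultimately have "ord z = ord y" using y(2) prime_nat_iff by blast
    then have "card (generate G {z}) = card (generate G {y})"
      using generate_pow_card zc y(1) by simp
    moreover have "finite (generate G {y})"
      using y generate_pow_card[OF y(1)] by (metis card.infinite not_prime_0)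
    moreover have "generate G {z} \<subseteq> K" using z(1) Ks(1) by (intro generate_subgroup_incl) auto
    ultimately show False using Ky by (metis card_seteq order.strict_implies_order psubsetE subset_trans order_refl)
  qed
  ultimately show "generate G {y} \<in> atoms (subgroup_poset G)" by (simp add: atoms_def)
qed

text \<open>An atom contains a subgroup of prime order and equals it by minimality.\<close>

lemma torsion_atom_subgroup_poset:
  assumes "torsion_group G" and a: "a \<in> atoms (subgroup_poset G)"
  obtains y where "y \<in> carrier G" "Factorial_Ring.prime (ord y)" "a = generate G {y}"
proof -
  have aP: "a \<in> subgroup_poset G" using a by (simp add: atoms_def)
  then have a': "subgroup a G" "a \<noteq> {\<one>}" by (auto simp: subgroup_poset_def)
  obtain y where y: "y \<in> a" "Factorial_Ring.prime (ord y)"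
    using torsion_ex_prime_ord[OF assms(1) a'] by blast
  have yc: "y \<in> carrier G" using y(1) a'(1) by (meson subgroup.mem_carrier)
  have "generate G {y} \<in> subgroup_poset G" "generate G {y} \<subseteq> a"
    using generate_prime_ord_in_atoms[OF yc y(2) aP y(1)] by (auto simp: atoms_def)
  then have "a = generate G {y}" using a by (auto simp: atoms_def)
  then show ?thesis using that yc y(2) by blast
qed

lemma generate_Union_is_join:
  assumes S: "S \<noteq> {}" "S \<subseteq> subgroup_poset G" and proper: "generate G (\<Union>S) \<noteq> carrier G"
  shows "is_join (subgroup_poset G) S (generate G (\<Union>S))"
proof -
  have Sc: "\<Union>S \<subseteq> carrier G"
    using S(2) by (auto simp: subgroup_poset_def dest: subgroup.mem_carrier)
  have sub: "subgroup (generate G (\<Union>S)) G" by (rule generate_is_subgroup[OF Sc])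
  have incl: "s \<subseteq> generate G (\<Union>S)" if "s \<in> S" for s
    using that by (auto intro: generate.incl)
  obtain s where s: "s \<in> S" using S(1) by blast
  then have "s \<noteq> {\<one>}" "\<one> \<in> s"
    using S(2) by (auto simp: subgroup_poset_def dest: subgroup.one_closed)
  then have "generate G (\<Union>S) \<noteq> {\<one>}" using incl[OF s] by blast
  then have "generate G (\<Union>S) \<in> subgroup_poset G"
    using sub proper by (simp add: subgroup_poset_def)
  moreover have "generate G (\<Union>S) \<subseteq> u" if "u \<in> subgroup_poset G" "\<forall>s\<in>S. s \<subseteq> u" for u
    using that by (intro generate_subgroup_incl) (auto simp: subgroup_poset_def)
  ultimately show ?thesis unfolding is_join_def using incl by blast
qed

lemma atomized_subgroup_poset:
  assumes tors: "torsion_group G"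
  shows "atomized (subgroup_poset G)"
  unfolding atomized_def
proof (intro conjI ballI allI impI)
  fix H assume HP: "H \<in> subgroup_poset G"
  then have H: "subgroup H G" "H \<noteq> {\<one>}" by (auto simp: subgroup_poset_def)
  obtain y where y: "y \<in> H" "Factorial_Ring.prime (ord y)"
    using torsion_ex_prime_ord[OF tors H] by blast
  have "y \<in> carrier G" using y(1) H(1) by (meson subgroup.mem_carrier)
  from generate_prime_ord_in_atoms[OF this y(2) HP y(1)]
  show "\<exists>a\<in>atoms (subgroup_poset G). a \<subseteq> H" by blast
next
  fix S assume S: "finite S \<and> S \<noteq> {} \<and> S \<subseteq> atoms (subgroup_poset G) \<and> has_upper_bound (subgroup_poset G) S"
  then have "\<exists>u\<in>subgroup_poset G. \<forall>s\<in>S. s \<subseteq> u" by (simp add: has_upper_bound_def)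
  then obtain u where u: "u \<in> subgroup_poset G" "\<forall>s\<in>S. s \<subseteq> u" by (rule bexE)
  have us: "subgroup u G" "u \<noteq> carrier G" using u(1) by (auto simp: subgroup_poset_def)
  have "generate G (\<Union>S) \<subseteq> u" using u(2) us(1) by (intro generate_subgroup_incl) auto
  then have "generate G (\<Union>S) \<noteq> carrier G" using us subgroup.subset by blast
  moreover have "S \<subseteq> subgroup_poset G" using S by (auto simp: atoms_def)
  ultimately show "\<exists>j. is_join (subgroup_poset G) S j"
    using generate_Union_is_join S by blast
qed

text \<open>Choosing one generator of prime order for each atom turns \<open>k\<close> atoms into at
  most \<open>k\<close> elements, which generate a proper subgroup containing all the atoms.\<close>

lemma subgroup_poset_has_upper_bound:
  assumes tors: "torsion_group G" and "k \<ge> 1"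
    and gen: "\<And>T. T \<subseteq> carrier G \<Longrightarrow> finite T \<Longrightarrow> card T \<le> k \<Longrightarrow>
      \<forall>x\<in>T. Factorial_Ring.prime (ord x) \<Longrightarrow> generate G T \<noteq> carrier G"
    and S: "finite S" "S \<subseteq> atoms (subgroup_poset G)" "card S \<le> k"
  shows "has_upper_bound (subgroup_poset G) S"
proof (cases "S = {}")
  case True
  have "carrier G \<noteq> {\<one>}" using gen[of "{}"] generate_empty by simp
  then obtain y where y: "y \<in> carrier G" "Factorial_Ring.prime (ord y)"
    using torsion_ex_prime_ord[OF tors subgroup_self] by blast
  \<comment> \<open>With no atoms given, a bound must still be a nontrivial proper subgroup;
    \<open>k \<ge> 1\<close> permits one generated by a single element.\<close>
  have "generate G {y} \<noteq> carrier G" using y \<open>k \<ge> 1\<close> by (intro gen) auto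
  moreover have "generate G {y} \<noteq> {\<one>}"
    using y(2) generate.incl[of y "{y}" G] by auto
  moreover have "subgroup (generate G {y}) G" using y(1) by (intro generate_is_subgroup) simp
  ultimately have "generate G {y} \<in> subgroup_poset G" by (simp add: subgroup_poset_def)
  then show ?thesis using True unfolding has_upper_bound_def by blast
next
  case False
  have "\<forall>a\<in>S. \<exists>y. y \<in> carrier G \<and> Factorial_Ring.prime (ord y) \<and> a = generate G {y}"
  proof
    fix a assume "a \<in> S"
    then have "a \<in> atoms (subgroup_poset G)" using S(2) by blast
    then show "\<exists>y. y \<in> carrier G \<and> Factorial_Ring.prime (ord y) \<and> a = generate G {y}"
      by (rule torsion_atom_subgroup_poset[OF tors]) blast
  qed
  from bchoice[OF this] obtain g where
    g: "\<forall>a\<in>S. g a \<in> carrier G \<and> Factorial_Ring.prime (ord (g a)) \<and> a = generate G {g a}" ..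
  have gc: "g ` S \<subseteq> carrier G" using g by blast
  have "card (g ` S) \<le> k" using card_image_le[OF S(1), of g] S(3) by simp
  then have proper: "generate G (g ` S) \<noteq> carrier G"
    using g S(1) by (intro gen) auto
  have sub: "subgroup (generate G (g ` S)) G" by (rule generate_is_subgroup[OF gc])
  have "a \<subseteq> generate G (g ` S)" if a: "a \<in> S" for a
  proof -
    have "generate G {g a} \<subseteq> generate G (g ` S)" using a by (intro mono_generate) blast
    then show ?thesis using g a by metis
  qed
  then have "generate G (\<Union>S) \<subseteq> generate G (g ` S)"
    by (intro generate_subgroup_incl[OF _ sub]) blast
  then have "generate G (\<Union>S) \<noteq> carrier G"
    using proper generate_incl[OF gc] by blast
  moreover have "S \<subseteq> subgroup_poset G" using S(2) by (auto simp: atoms_def)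
  ultimately have "is_join (subgroup_poset G) S (generate G (\<Union>S))"
    using False by (intro generate_Union_is_join)
  then show ?thesis unfolding is_join_def has_upper_bound_def by blast
qed

end

theorem mainTheorem1:
  fixes k :: nat
  assumes "k \<ge> 1"
  shows
    "(\<forall>P :: 'a::order set.
        atomized P \<longrightarrow>
        (\<forall>S. finite S \<and> S \<subseteq> atoms P \<and> card S \<le> k \<longrightarrow> has_upper_bound P S) \<longrightarrow>
        n_connected (int k - 2) (realization P))
   \<and> (\<forall>G :: ('g, 'b) monoid_scheme.
        group G \<longrightarrow>
        \<not> (\<exists>S. S \<subseteq> carrier G \<and> finite S \<and> card S \<le> k \<and> generate G S = carrier G) \<longrightarrow>
        n_connected (int k - 1) (realization (coset_poset G)))
   \<and> (\<forall>G :: ('g, 'b) monoid_scheme.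
        group G \<longrightarrow> torsion_group G \<longrightarrow>
        (\<forall>S. S \<subseteq> carrier G \<and> finite S \<and> card S \<le> k \<and> (\<forall>x\<in>S. Factorial_Ring.prime (group.ord G x))
             \<longrightarrow> generate G S \<noteq> carrier G) \<longrightarrow>
        n_connected (int k - 2) (realization (subgroup_poset G)))"
proof (intro conjI allI impI)
  fix P :: "'a set"
  assume "atomized P" "\<forall>S. finite S \<and> S \<subseteq> atoms P \<and> card S \<le> k \<longrightarrow> has_upper_bound P S"
  then show "n_connected (int k - 2) (realization P)"
    by (intro atomized_n_connected) simp_all
next
  fix G :: "('g, 'b) monoid_scheme"
  assume G: "group G"
    and gen: "\<not> (\<exists>S. S \<subseteq> carrier G \<and> finite S \<and> card S \<le> k \<and> generate G S = carrier G)"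
  have "carrier G \<noteq> {\<one>\<^bsub>G\<^esub>}" using gen group.generate_empty[OF G] by force
  then have "atomized (coset_poset G)" by (rule group.atomized_coset_poset[OF G])
  moreover have "has_upper_bound (coset_poset G) S"
    if "finite S" "S \<subseteq> atoms (coset_poset G)" "card S \<le> Suc k" for S
    using gen by (intro group.coset_poset_has_upper_bound[OF G _ that]) simp
  \<comment> \<open>The general result is applied with \<open>Suc k\<close> atoms, since
    \<open>k + 1\<close> singletons are bounded.\<close>
  ultimately have "n_connected (int (Suc k) - 2) (realization (coset_poset G))"
    by (rule atomized_n_connected)
  then show "n_connected (int k - 1) (realization (coset_poset G))" by simp
next
  fix G :: "('g, 'b) monoid_scheme"
  assume G: "group G" and tors: "torsion_group G"
    and gen: "\<forall>S. S \<subseteq> carrier G \<and> finite S \<and> card S \<le> k \<and>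
      (\<forall>x\<in>S. Factorial_Ring.prime (group.ord G x)) \<longrightarrow> generate G S \<noteq> carrier G"
  have "atomized (subgroup_poset G)" by (rule group.atomized_subgroup_poset[OF G tors])
  moreover have "has_upper_bound (subgroup_poset G) S"
    if "finite S" "S \<subseteq> atoms (subgroup_poset G)" "card S \<le> k" for S
    using gen by (intro group.subgroup_poset_has_upper_bound[OF G tors assms _ that]) simp
  ultimately show "n_connected (int k - 2) (realization (subgroup_poset G))"
    by (rule atomized_n_connected)
qed

end
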